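(* Let $\mathcal{C}$ be an abelian category and let $E,F$ be allowable classes in $\mathcal{C}$ with $F\subseteq E$. Suppose each of the following conditions is satisfied: (1) $F$ has retractile monics; (2) $E$ has retractile monics and sectile epics; (3) $\mathcal{C}$ has enough $F$-injectives; (4) $\mathcal{C}$ has enough $E$-projectives and enough $E$-injectives; (5) every $E$-projective object is $E$-injective. Then there exists a Waldhausen category structure on $\mathcal{C}$ in which the cofibrations are the $F$-monomorphisms and the weak equivalences are the $E$-stable equivalences. This Waldhausen category (denoted $\mathcal{C}_{E-we}^{F-cof}$) satisfies the saturation axiom and the extension axiom.
   Context: **Relative homological algebra.** An allowable class $E$ in an abelian category $\mathcal{C}$ is a collection of short exact sequences in $\mathcal{C}$, closed under isomorphism of short exact sequences and containing every short exact sequence in which at least one object is zero. A monomorphism $f:M\to N$ is an $E$-monomorphism (or $E$-monic) if $0\to M\xrightarrow{f} N\to \operatorname{coker} f\to 0$ is in $E$. An epimorphism $f: M\to N$ is an $E$-epimorphism (or $E$-epic) if $0\to\ker f\to M\xrightarrow{f} N\to 0$ is in $E$. An object $X$ is $E$-projective if for every $E$-epic $f:M\to N$, every map $X\to N$ lifts through $f$ to a map $X\to M$; $X$ is $E$-injective if for every $E$-monic $f:M\to N$, every map $M\to X$ extends along $f$ to a map $N\to X$. $\mathcal{C}$ has enough $E$-projectives if every object $M$ admits an $E$-epic $N\to M$ with $N$ $E$-projective; it has enough $E$-injectives if every object $M$ admits an $E$-monic $M\to N$ with $N$ $E$-injective. $E$ has retractile monics if whenever $g\circ f$ is an $E$-monic,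 $f$ is an $E$-monic; $E$ has sectile epics if whenever $g\circ f$ is an $E$-epic, $g$ is an $E$-epic. Maps $f,g:M\to N$ are $E$-stably equivalent, written $f\simeq g$, if $f-g$ factors through an $E$-projective object. A map $f:M\to N$ is an $E$-stable equivalence if there is $h:N\to M$ with $f\circ h\simeq \mathrm{id}_N$ and $h\circ f\simeq\mathrm{id}_M$. **Waldhausen categories.** A Waldhausen category is a pointed category (zero object $\mathrm{pt}$) with finite pushouts, with a specified class of cofibrations and a specified class of weak equivalences, both closed under composition, such that: (Cof 1) isomorphisms are cofibrations; (Cof 2) $\mathrm{pt}\to X$ is a cofibration for every object $X$; (Cof 3) if $X\to Y$ is a morphism and $X\to Z$ a cofibration, then $Y\to Y\coprod_X Z$ is a cofibration; (Weq 1) isomorphisms are weak equivalences; (Weq 2) given a commutative diagram with rows $Y\leftarrow X\to Z$ and $Y'\leftarrow X'\to Z'$ and vertical maps from the first row to the second, with $X\to Y$ and $X'\to Y'$ cofibrations and all three vertical maps weak equivalences, the induced map $Y\coprod_X Z\to Y'\coprod_{X'}Z'$ is a weak equivalence. Saturation axiom: if $f,g$ are composable and two of $f,g,g\circ f$ are weak equivalences, so is the third. Extension axiom: given a map of cofiber sequences from $X\to Y\to Y/X$ to $X'\to Y'\to Y'/X'$ such that $X\to X'$ and $Y/X\to Y'/X'$ are weak equivalences, $Y\to Y'$ is a weak equivalence. *)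

theory Defs
  imports "HOL-Algebra.Group"
begin

text \<open>
  Categories are single-sorted in their arrows: every arrow has one domain and one codomain, and
  \<open>g \<cdot>\<^bsub>C\<^esub> f\<close> is "first \<open>f\<close>, then \<open>g\<close>", meaningful only when \<open>Dom C g = Cod C f\<close>.
\<close>

record ('o, 'a) cat =
  Obj :: "'o set"
  Arr :: "'a set"
  Dom :: "'a \<Rightarrow> 'o"
  Cod :: "'a \<Rightarrow> 'o"
  Ident :: "'o \<Rightarrow> 'a"
  Comp :: "'a \<Rightarrow> 'a \<Rightarrow> 'a"  (infixl "\<cdot>\<index>" 70)

definition Hom :: "('o, 'a, 'z) cat_scheme \<Rightarrow> 'o \<Rightarrow> 'o \<Rightarrow> 'a set" where
  "Hom C X Y = {f \<in> Arr C. Dom C f = X \<and> Cod C f = Y}"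

definition composable :: "('o, 'a, 'z) cat_scheme \<Rightarrow> 'a \<Rightarrow> 'a \<Rightarrow> bool" where
  "composable C g f \<longleftrightarrow> f \<in> Arr C \<and> g \<in> Arr C \<and> Dom C g = Cod C f"

locale category =
  fixes C :: "('o, 'a, 'z) cat_scheme" (structure)
  assumes Dom_in_Obj: "f \<in> Arr C \<Longrightarrow> Dom C f \<in> Obj C"
    and Cod_in_Obj: "f \<in> Arr C \<Longrightarrow> Cod C f \<in> Obj C"
    and Ident_in_Hom: "X \<in> Obj C \<Longrightarrow> Ident C X \<in> Hom C X X"
    and Comp_in_Hom: "f \<in> Hom C X Y \<Longrightarrow> g \<in> Hom C Y Z \<Longrightarrow> g \<cdot> f \<in> Hom C X Z"
    and Comp_Ident_right: "f \<in> Hom C X Y \<Longrightarrow> f \<cdot> Ident C X = f"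
    and Comp_Ident_left: "f \<in> Hom C X Y \<Longrightarrow> Ident C Y \<cdot> f = f"
    and Comp_assoc:
      "f \<in> Hom C W X \<Longrightarrow> g \<in> Hom C X Y \<Longrightarrow> h \<in> Hom C Y Z \<Longrightarrow> (h \<cdot> g) \<cdot> f = h \<cdot> (g \<cdot> f)"

definition iso_arr :: "('o, 'a, 'z) cat_scheme \<Rightarrow> 'a \<Rightarrow> bool" where
  "iso_arr C f \<longleftrightarrow> f \<in> Arr C \<and>
     (\<exists>g \<in> Hom C (Cod C f) (Dom C f).
        g \<cdot>\<^bsub>C\<^esub> f = Ident C (Dom C f) \<and> f \<cdot>\<^bsub>C\<^esub> g = Ident C (Cod C f))"

definition monic :: "('o, 'a, 'z) cat_scheme \<Rightarrow> 'a \<Rightarrow> bool" where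
  "monic C f \<longleftrightarrow> f \<in> Arr C \<and>
     (\<forall>W \<in> Obj C. \<forall>u \<in> Hom C W (Dom C f). \<forall>v \<in> Hom C W (Dom C f).
        f \<cdot>\<^bsub>C\<^esub> u = f \<cdot>\<^bsub>C\<^esub> v \<longrightarrow> u = v)"

definition epic :: "('o, 'a, 'z) cat_scheme \<Rightarrow> 'a \<Rightarrow> bool" where
  "epic C f \<longleftrightarrow> f \<in> Arr C \<and>
     (\<forall>W \<in> Obj C. \<forall>u \<in> Hom C (Cod C f) W. \<forall>v \<in> Hom C (Cod C f) W.
        u \<cdot>\<^bsub>C\<^esub> f = v \<cdot>\<^bsub>C\<^esub> f \<longrightarrow> u = v)"

definition zero_object :: "('o, 'a, 'z) cat_scheme \<Rightarrow> 'o \<Rightarrow> bool" where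
  "zero_object C Z \<longleftrightarrow> Z \<in> Obj C \<and>
     (\<forall>X \<in> Obj C. (\<exists>!f. f \<in> Hom C X Z) \<and> (\<exists>!f. f \<in> Hom C Z X))"

text \<open>
  \<open>pushout_square C f g i j\<close>: with \<open>f : X \<rightarrow> Y\<close>, \<open>g : X \<rightarrow> Z\<close>, the arrows \<open>i : Y \<rightarrow> P\<close> and
  \<open>j : Z \<rightarrow> P\<close> exhibit \<open>P\<close> as a pushout of \<open>Y \<leftarrow> X \<rightarrow> Z\<close>.
\<close>

definition pushout_square :: "('o, 'a, 'z) cat_scheme \<Rightarrow> 'a \<Rightarrow> 'a \<Rightarrow> 'a \<Rightarrow> 'a \<Rightarrow> bool" where
  "pushout_square C f g i j \<longleftrightarrow>
     f \<in> Arr C \<and> g \<in> Arr C \<and> Dom C f = Dom C g \<and>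
     i \<in> Hom C (Cod C f) (Cod C i) \<and> j \<in> Hom C (Cod C g) (Cod C i) \<and>
     i \<cdot>\<^bsub>C\<^esub> f = j \<cdot>\<^bsub>C\<^esub> g \<and>
     (\<forall>Q \<in> Obj C. \<forall>u \<in> Hom C (Cod C f) Q. \<forall>v \<in> Hom C (Cod C g) Q.
        u \<cdot>\<^bsub>C\<^esub> f = v \<cdot>\<^bsub>C\<^esub> g \<longrightarrow>
        (\<exists>!w. w \<in> Hom C (Cod C i) Q \<and> w \<cdot>\<^bsub>C\<^esub> i = u \<and> w \<cdot>\<^bsub>C\<^esub> j = v))"


section \<open>Abelian categories\<close>

record ('o, 'a) add_cat = "('o, 'a) cat" +
  Add :: "'a \<Rightarrow> 'a \<Rightarrow> 'a"
  Zero :: "'o \<Rightarrow> 'o \<Rightarrow> 'a"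

text \<open>The group law of the hom-groups is the addition of arrows, in multiplicative notation.\<close>

definition Hom_group :: "('o, 'a, 'z) add_cat_scheme \<Rightarrow> 'o \<Rightarrow> 'o \<Rightarrow> 'a monoid" where
  "Hom_group C X Y = \<lparr>carrier = Hom C X Y, mult = Add C, one = Zero C X Y\<rparr>"

definition Minus :: "('o, 'a, 'z) add_cat_scheme \<Rightarrow> 'a \<Rightarrow> 'a \<Rightarrow> 'a" where
  "Minus C f g = Add C f (inv\<^bsub>Hom_group C (Dom C g) (Cod C g)\<^esub> g)"

locale preadditive_category = category C
  for C :: "('o, 'a, 'z) add_cat_scheme" (structure) +
  assumes Hom_comm_group: "X \<in> Obj C \<Longrightarrow> Y \<in> Obj C \<Longrightarrow> comm_group (Hom_group C X Y)"
    and Comp_Add_right: "f \<in> Hom C X Y \<Longrightarrow> g \<in> Hom C X Y \<Longrightarrow> h \<in> Hom C Y Z \<Longrightarrow>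
           h \<cdot> Add C f g = Add C (h \<cdot> f) (h \<cdot> g)"
    and Comp_Add_left: "f \<in> Hom C X Y \<Longrightarrow> g \<in> Hom C Y Z \<Longrightarrow> h \<in> Hom C Y Z \<Longrightarrow>
           Add C g h \<cdot> f = Add C (g \<cdot> f) (h \<cdot> f)"

definition is_kernel :: "('o, 'a, 'z) add_cat_scheme \<Rightarrow> 'a \<Rightarrow> 'a \<Rightarrow> bool" where
  "is_kernel C k f \<longleftrightarrow> composable C f k \<and>
     f \<cdot>\<^bsub>C\<^esub> k = Zero C (Dom C k) (Cod C f) \<and>
     (\<forall>W \<in> Obj C. \<forall>u \<in> Hom C W (Dom C f). f \<cdot>\<^bsub>C\<^esub> u = Zero C W (Cod C f) \<longrightarrow>
        (\<exists>!v. v \<in> Hom C W (Dom C k) \<and> k \<cdot>\<^bsub>C\<^esub> v = u))"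

definition is_cokernel :: "('o, 'a, 'z) add_cat_scheme \<Rightarrow> 'a \<Rightarrow> 'a \<Rightarrow> bool" where
  "is_cokernel C c f \<longleftrightarrow> composable C c f \<and>
     c \<cdot>\<^bsub>C\<^esub> f = Zero C (Dom C f) (Cod C c) \<and>
     (\<forall>W \<in> Obj C. \<forall>u \<in> Hom C (Cod C f) W. u \<cdot>\<^bsub>C\<^esub> f = Zero C (Dom C f) W \<longrightarrow>
        (\<exists>!v. v \<in> Hom C (Cod C c) W \<and> v \<cdot>\<^bsub>C\<^esub> c = u))"

text \<open>
  \<open>is_biproduct C X Y i\<^sub>1 i\<^sub>2 p\<^sub>1 p\<^sub>2\<close>: the common codomain of the injections \<open>i\<^sub>1, i\<^sub>2\<close> (which is
  the common domain of the projections) is a biproduct of \<open>X\<close> and \<open>Y\<close>.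
\<close>

definition is_biproduct ::
  "('o, 'a, 'z) add_cat_scheme \<Rightarrow> 'o \<Rightarrow> 'o \<Rightarrow> 'a \<Rightarrow> 'a \<Rightarrow> 'a \<Rightarrow> 'a \<Rightarrow> bool" where
  "is_biproduct C X Y i\<^sub>1 i\<^sub>2 p\<^sub>1 p\<^sub>2 \<longleftrightarrow> (\<exists>S \<in> Obj C.
     i\<^sub>1 \<in> Hom C X S \<and> i\<^sub>2 \<in> Hom C Y S \<and> p\<^sub>1 \<in> Hom C S X \<and> p\<^sub>2 \<in> Hom C S Y \<and>
     p\<^sub>1 \<cdot>\<^bsub>C\<^esub> i\<^sub>1 = Ident C X \<and> p\<^sub>2 \<cdot>\<^bsub>C\<^esub> i\<^sub>2 = Ident C Y \<and>
     Add C (i\<^sub>1 \<cdot>\<^bsub>C\<^esub> p\<^sub>1) (i\<^sub>2 \<cdot>\<^bsub>C\<^esub> p\<^sub>2) = Ident C S)"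

locale abelian_category = preadditive_category C
  for C :: "('o, 'a, 'z) add_cat_scheme" (structure) +
  assumes ex_zero_object: "\<exists>Z. zero_object C Z"
    and ex_biproduct: "X \<in> Obj C \<Longrightarrow> Y \<in> Obj C \<Longrightarrow> \<exists>i\<^sub>1 i\<^sub>2 p\<^sub>1 p\<^sub>2. is_biproduct C X Y i\<^sub>1 i\<^sub>2 p\<^sub>1 p\<^sub>2"
    and ex_kernel: "f \<in> Arr C \<Longrightarrow> \<exists>k. is_kernel C k f"
    and ex_cokernel: "f \<in> Arr C \<Longrightarrow> \<exists>c. is_cokernel C c f"
    and monic_normal: "monic C f \<Longrightarrow> \<exists>g. is_kernel C f g"
    and epic_normal: "epic C f \<Longrightarrow> \<exists>g. is_cokernel C f g"


section \<open>Relative homological algebra\<close>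

text \<open>
  The pair \<open>(f, g)\<close> stands for the sequence \<open>0 \<rightarrow> Dom f \<rightarrow> Cod f = Dom g \<rightarrow> Cod g \<rightarrow> 0\<close>.
\<close>

definition short_exact :: "('o, 'a, 'z) add_cat_scheme \<Rightarrow> 'a \<times> 'a \<Rightarrow> bool" where
  "short_exact C = (\<lambda>(f, g). is_kernel C f g \<and> is_cokernel C g f)"

definition iso_sequences :: "('o, 'a, 'z) add_cat_scheme \<Rightarrow> 'a \<times> 'a \<Rightarrow> 'a \<times> 'a \<Rightarrow> bool" where
  "iso_sequences C = (\<lambda>(f, g) (f', g'). \<exists>a b c.
     iso_arr C a \<and> iso_arr C b \<and> iso_arr C c \<and>
     a \<in> Hom C (Dom C f) (Dom C f') \<and>
     b \<in> Hom C (Cod C f) (Cod C f') \<and>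
     c \<in> Hom C (Cod C g) (Cod C g') \<and>
     b \<cdot>\<^bsub>C\<^esub> f = f' \<cdot>\<^bsub>C\<^esub> a \<and> c \<cdot>\<^bsub>C\<^esub> g = g' \<cdot>\<^bsub>C\<^esub> b)"

definition allowable_class :: "('o, 'a, 'z) add_cat_scheme \<Rightarrow> ('a \<times> 'a) set \<Rightarrow> bool" where
  "allowable_class C E \<longleftrightarrow>
     (\<forall>s \<in> E. short_exact C s) \<and>
     (\<forall>s \<in> E. \<forall>t. short_exact C t \<and> iso_sequences C s t \<longrightarrow> t \<in> E) \<and>
     (\<forall>f g. short_exact C (f, g) \<and>
        (zero_object C (Dom C f) \<or> zero_object C (Cod C f) \<or> zero_object C (Cod C g)) \<longrightarrow>
        (f, g) \<in> E)"

text \<open>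
  Cokernels and kernels are unique up to isomorphism and allowable classes are closed under
  isomorphism, so it does not matter which (co)kernel is used in the next two definitions.
\<close>

definition rel_monic :: "('o, 'a, 'z) add_cat_scheme \<Rightarrow> ('a \<times> 'a) set \<Rightarrow> 'a \<Rightarrow> bool" where
  "rel_monic C E f \<longleftrightarrow> monic C f \<and> (\<exists>c. is_cokernel C c f \<and> (f, c) \<in> E)"

definition rel_epic :: "('o, 'a, 'z) add_cat_scheme \<Rightarrow> ('a \<times> 'a) set \<Rightarrow> 'a \<Rightarrow> bool" where
  "rel_epic C E f \<longleftrightarrow> epic C f \<and> (\<exists>k. is_kernel C k f \<and> (k, f) \<in> E)"

definition rel_projective :: "('o, 'a, 'z) add_cat_scheme \<Rightarrow> ('a \<times> 'a) set \<Rightarrow> 'o \<Rightarrow> bool" where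
  "rel_projective C E X \<longleftrightarrow> X \<in> Obj C \<and>
     (\<forall>f. rel_epic C E f \<longrightarrow>
        (\<forall>x \<in> Hom C X (Cod C f). \<exists>y \<in> Hom C X (Dom C f). f \<cdot>\<^bsub>C\<^esub> y = x))"

definition rel_injective :: "('o, 'a, 'z) add_cat_scheme \<Rightarrow> ('a \<times> 'a) set \<Rightarrow> 'o \<Rightarrow> bool" where
  "rel_injective C E X \<longleftrightarrow> X \<in> Obj C \<and>
     (\<forall>f. rel_monic C E f \<longrightarrow>
        (\<forall>x \<in> Hom C (Dom C f) X. \<exists>y \<in> Hom C (Cod C f) X. y \<cdot>\<^bsub>C\<^esub> f = x))"

definition enough_projectives :: "('o, 'a, 'z) add_cat_scheme \<Rightarrow> ('a \<times> 'a) set \<Rightarrow> bool" where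
  "enough_projectives C E \<longleftrightarrow>
     (\<forall>M \<in> Obj C. \<exists>N. rel_projective C E N \<and> (\<exists>f \<in> Hom C N M. rel_epic C E f))"

definition enough_injectives :: "('o, 'a, 'z) add_cat_scheme \<Rightarrow> ('a \<times> 'a) set \<Rightarrow> bool" where
  "enough_injectives C E \<longleftrightarrow>
     (\<forall>M \<in> Obj C. \<exists>N. rel_injective C E N \<and> (\<exists>f \<in> Hom C M N. rel_monic C E f))"

definition retractile_monics :: "('o, 'a, 'z) add_cat_scheme \<Rightarrow> ('a \<times> 'a) set \<Rightarrow> bool" where
  "retractile_monics C E \<longleftrightarrow>
     (\<forall>f g. composable C g f \<and> rel_monic C E (g \<cdot>\<^bsub>C\<^esub> f) \<longrightarrow> rel_monic C E f)"

definition sectile_epics :: "('o, 'a, 'z) add_cat_scheme \<Rightarrow> ('a \<times> 'a) set \<Rightarrow> bool" where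
  "sectile_epics C E \<longleftrightarrow>
     (\<forall>f g. composable C g f \<and> rel_epic C E (g \<cdot>\<^bsub>C\<^esub> f) \<longrightarrow> rel_epic C E g)"

definition stably_equivalent ::
  "('o, 'a, 'z) add_cat_scheme \<Rightarrow> ('a \<times> 'a) set \<Rightarrow> 'a \<Rightarrow> 'a \<Rightarrow> bool" where
  "stably_equivalent C E f g \<longleftrightarrow>
     f \<in> Arr C \<and> g \<in> Arr C \<and> Dom C f = Dom C g \<and> Cod C f = Cod C g \<and>
     (\<exists>P. rel_projective C E P \<and>
        (\<exists>a \<in> Hom C (Dom C f) P. \<exists>b \<in> Hom C P (Cod C f). Minus C f g = b \<cdot>\<^bsub>C\<^esub> a))"

definition stable_equivalence :: "('o, 'a, 'z) add_cat_scheme \<Rightarrow> ('a \<times> 'a) set \<Rightarrow> 'a \<Rightarrow> bool" where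
  "stable_equivalence C E f \<longleftrightarrow> f \<in> Arr C \<and>
     (\<exists>h \<in> Hom C (Cod C f) (Dom C f).
        stably_equivalent C E (f \<cdot>\<^bsub>C\<^esub> h) (Ident C (Cod C f)) \<and>
        stably_equivalent C E (h \<cdot>\<^bsub>C\<^esub> f) (Ident C (Dom C f)))"


section \<open>Waldhausen categories\<close>

locale waldhausen_category = category C
  for C :: "('o, 'a, 'z) cat_scheme" (structure) +
  fixes pt :: 'o and cof :: "'a set" and weq :: "'a set"
  assumes pt_zero: "zero_object C pt"
    and ex_pushout: "f \<in> Arr C \<Longrightarrow> g \<in> Arr C \<Longrightarrow> Dom C f = Dom C g \<Longrightarrow>
           \<exists>i j. pushout_square C f g i j"
    and cof_Arr: "cof \<subseteq> Arr C"
    and weq_Arr: "weq \<subseteq> Arr C"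
    and cof_comp: "f \<in> cof \<Longrightarrow> g \<in> cof \<Longrightarrow> composable C g f \<Longrightarrow> g \<cdot> f \<in> cof"
    and weq_comp: "f \<in> weq \<Longrightarrow> g \<in> weq \<Longrightarrow> composable C g f \<Longrightarrow> g \<cdot> f \<in> weq"
    and Cof1: "iso_arr C f \<Longrightarrow> f \<in> cof"
    and Cof2: "X \<in> Obj C \<Longrightarrow> f \<in> Hom C pt X \<Longrightarrow> f \<in> cof"
    and Cof3: "g \<in> cof \<Longrightarrow> pushout_square C f g i j \<Longrightarrow> i \<in> cof"
    and Weq1: "iso_arr C f \<Longrightarrow> f \<in> weq"
    and Weq2: "pushout_square C f g i j \<Longrightarrow> pushout_square C f' g' i' j' \<Longrightarrow>
           f \<in> cof \<Longrightarrow> f' \<in> cof \<Longrightarrow>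
           x \<in> weq \<Longrightarrow> y \<in> weq \<Longrightarrow> z \<in> weq \<Longrightarrow>
           x \<in> Hom C (Dom C f) (Dom C f') \<Longrightarrow>
           y \<in> Hom C (Cod C f) (Cod C f') \<Longrightarrow>
           z \<in> Hom C (Cod C g) (Cod C g') \<Longrightarrow>
           y \<cdot> f = f' \<cdot> x \<Longrightarrow> z \<cdot> g = g' \<cdot> x \<Longrightarrow>
           w \<in> Hom C (Cod C i) (Cod C i') \<Longrightarrow> w \<cdot> i = i' \<cdot> y \<Longrightarrow> w \<cdot> j = j' \<cdot> z \<Longrightarrow>
           w \<in> weq"

definition saturation_axiom :: "('o, 'a, 'z) cat_scheme \<Rightarrow> 'a set \<Rightarrow> bool" where
  "saturation_axiom C weq \<longleftrightarrow> (\<forall>f g. composable C g f \<longrightarrow>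
     (f \<in> weq \<and> g \<in> weq \<longrightarrow> g \<cdot>\<^bsub>C\<^esub> f \<in> weq) \<and>
     (f \<in> weq \<and> g \<cdot>\<^bsub>C\<^esub> f \<in> weq \<longrightarrow> g \<in> weq) \<and>
     (g \<in> weq \<and> g \<cdot>\<^bsub>C\<^esub> f \<in> weq \<longrightarrow> f \<in> weq))"

text \<open>\<open>X \<rightarrow> Y \<rightarrow> Y/X\<close>, where \<open>Y/X\<close> is a pushout of \<open>Y \<leftarrow> X \<rightarrow> pt\<close>.\<close>

definition cofiber_sequence ::
  "('o, 'a, 'z) cat_scheme \<Rightarrow> 'o \<Rightarrow> 'a set \<Rightarrow> 'a \<Rightarrow> 'a \<Rightarrow> bool" where
  "cofiber_sequence C pt cof f q \<longleftrightarrow> f \<in> cof \<and>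
     (\<exists>t \<in> Hom C (Dom C f) pt. \<exists>s \<in> Hom C pt (Cod C q). pushout_square C f t q s)"

definition extension_axiom ::
  "('o, 'a, 'z) cat_scheme \<Rightarrow> 'o \<Rightarrow> 'a set \<Rightarrow> 'a set \<Rightarrow> bool" where
  "extension_axiom C pt cof weq \<longleftrightarrow> (\<forall>f q f' q' x y z.
     cofiber_sequence C pt cof f q \<and> cofiber_sequence C pt cof f' q' \<and>
     x \<in> Hom C (Dom C f) (Dom C f') \<and>
     y \<in> Hom C (Cod C f) (Cod C f') \<and>
     z \<in> Hom C (Cod C q) (Cod C q') \<and>
     y \<cdot>\<^bsub>C\<^esub> f = f' \<cdot>\<^bsub>C\<^esub> x \<and> z \<cdot>\<^bsub>C\<^esub> q = q' \<cdot>\<^bsub>C\<^esub> y \<and>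
     x \<in> weq \<and> z \<in> weq \<longrightarrow> y \<in> weq)"

end

theory Submission
  imports Defs
begin

text \<open>
  Call a map null if it factors through an \<open>E\<close>-projective object. Null maps form an ideal, so stable
  equivalences are the maps that become invertible modulo an ideal; this gives two out of three and
  the saturation axiom. On the side of the cofibrations, enough \<open>F\<close>-injectives and retractile monics
  make \<open>F\<close>-monics recognizable by an extension property: \<open>f\<close> is \<open>F\<close>-monic as soon as some \<open>F\<close>-monic
  out of its source extends along \<open>f\<close>. Hence they are closed under composition and
  pushout (\<open>rel_monic_comp\<close>, \<open>pushout_rel_monic\<close>), and the same applies to \<open>E\<close>-monics.

  The substance lies in the gluing and extension axioms. A stable equivalence \<open>x\<close> has an inverse \<open>h\<close>
  with \<open>h x = 1 - b a\<close> and \<open>x h = 1 - b' a'\<close> for some \<open>a, b\<close> through a projective \<open>P\<close> and \<open>a', b'\<close>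
  through a projective \<open>P'\<close>. These data can be chosen coherently: after enlarging \<open>P'\<close> there is
  \<open>c : P \<rightarrow> P'\<close> with \<open>a' x = c a\<close> and \<open>x b = b' c\<close> (\<open>coherent_inverse\<close>). The two factorizations then
  match each other under \<open>x\<close>, so they can be glued into maps out of a pushout or into a pullback, and
  three statements become explicit computations on both legs of such a square:

    \<^item> stable equivalences are stable under pushout along an \<open>E\<close>-monic, because \<open>a\<close> extends along it,
      projectives being injective (\<open>pushout_stable_equivalence\<close>);
    \<^item> stable equivalences are stable under pullback along the cokernel of an \<open>E\<close>-monic, because \<open>b'\<close>
      lifts through it (\<open>pullback_stable_equivalence\<close>);
    \<^item> a stable equivalence between two objects under \<open>X\<close> remains one after cobase change along any
      \<open>X \<rightarrow> Z\<close>, provided that the structure map of the target is \<open>E\<close>-monic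
      (\<open>pushout_stable_equivalence_under\<close>).

  The comparison map in the gluing axiom is a composite of a map of the first kind and one of the
  third kind. For the extension axiom, a map from \<open>X \<rightarrow> Y \<rightarrow> Z\<close> to \<open>X' \<rightarrow> Y' \<rightarrow> Z'\<close> factors
  \<open>Y \<rightarrow> Y'\<close> through the pushout \<open>W\<close> of \<open>Y \<leftarrow> X \<rightarrow> X'\<close>; the first half is the pushout of \<open>X \<rightarrow> X'\<close>, and
  since \<open>W\<close> is also the pullback of \<open>Y' \<rightarrow> Z' \<leftarrow> Z\<close>, the second half is the pullback of \<open>Z \<rightarrow> Z'\<close>.
\<close>

section \<open>Arithmetic of arrows\<close>

text \<open>
  Equations between arrows are proved below by rewriting both sides to sums of right-nested
  composites. The typing side conditions of the rewrite rules are therefore stated with domains and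
  codomains: a premise of the form \<open>f \<in> Hom C X Y\<close> would introduce objects that do not occur in the
  redex and that rewriting cannot guess.
\<close>

context category
begin

lemma HomD:
  assumes "f \<in> Hom C X Y"
  shows "f \<in> Arr C" "Dom C f = X" "Cod C f = Y" "X \<in> Obj C" "Y \<in> Obj C"
  using assms Dom_in_Obj Cod_in_Obj by (auto simp: Hom_def)

lemma HomI: "f \<in> Arr C \<Longrightarrow> Dom C f = X \<Longrightarrow> Cod C f = Y \<Longrightarrow> f \<in> Hom C X Y"
  by (simp add: Hom_def)

lemma Comp_typing [simp]:
  assumes "f \<in> Arr C" "g \<in> Arr C" "Dom C g = Cod C f"
  shows "g \<cdot> f \<in> Arr C" "Dom C (g \<cdot> f) = Dom C f" "Cod C (g \<cdot> f) = Cod C g"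
  using HomD[OF Comp_in_Hom[OF HomI HomI]] assms by auto

lemma Ident_typing [simp]:
  assumes "X \<in> Obj C"
  shows "Ident C X \<in> Arr C" "Dom C (Ident C X) = X" "Cod C (Ident C X) = X"
  using HomD[OF Ident_in_Hom] assms by auto

lemma Dom_Cod_Obj [simp]: "f \<in> Arr C \<Longrightarrow> Dom C f \<in> Obj C" "f \<in> Arr C \<Longrightarrow> Cod C f \<in> Obj C"
  by (rule Dom_in_Obj Cod_in_Obj, assumption)+

lemma Comp_Ident [simp]:
  "f \<in> Arr C \<Longrightarrow> Dom C f = X \<Longrightarrow> f \<cdot> Ident C X = f"
  "f \<in> Arr C \<Longrightarrow> Cod C f = X \<Longrightarrow> Ident C X \<cdot> f = f"
  by (auto intro: Comp_Ident_left Comp_Ident_right HomI)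

lemma assoc [simp]:
  "f \<in> Arr C \<Longrightarrow> g \<in> Arr C \<Longrightarrow> h \<in> Arr C \<Longrightarrow> Dom C g = Cod C f \<Longrightarrow> Dom C h = Cod C g \<Longrightarrow>
   (h \<cdot> g) \<cdot> f = h \<cdot> (g \<cdot> f)"
  by (rule Comp_assoc) (auto intro: HomI)

text \<open>Makes an equation between composites applicable inside a longer right-nested composite.\<close>

lemma reassoc:
  "g \<cdot> f = h \<Longrightarrow> f \<in> Arr C \<Longrightarrow> g \<in> Arr C \<Longrightarrow> Dom C g = Cod C f \<Longrightarrow>
   u \<in> Arr C \<Longrightarrow> Cod C u = Dom C f \<Longrightarrow> g \<cdot> (f \<cdot> u) = h \<cdot> u"
  using assoc[of u f g] by simp

end

context preadditive_category
begin

abbreviation plus_arr (infixl "\<oplus>" 65) where "f \<oplus> g \<equiv> Add C f g"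
abbreviation minus_arr (infixl "\<ominus>" 65) where "f \<ominus> g \<equiv> Minus C f g"

definition parallel :: "'a \<Rightarrow> 'a \<Rightarrow> bool" where
  "parallel f g \<longleftrightarrow> f \<in> Arr C \<and> g \<in> Arr C \<and> Dom C g = Dom C f \<and> Cod C g = Cod C f"

lemma Add_group:
  assumes "f \<in> Arr C"
  defines "G \<equiv> Hom_group C (Dom C f) (Cod C f)"
  shows "comm_group G" "f \<in> carrier G" "parallel f g \<Longrightarrow> g \<in> carrier G"
    "mult G = Add C" "one G = Zero C (Dom C f) (Cod C f)"
    "g \<in> carrier G \<Longrightarrow> parallel f g"
    "g \<in> carrier G \<Longrightarrow> f \<ominus> g = f \<oplus> inv\<^bsub>G\<^esub> g"
  using assms Hom_comm_group by (auto simp: parallel_def Hom_group_def Hom_def Minus_def)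

lemma Zero_typing [simp]:
  assumes "X \<in> Obj C" "Y \<in> Obj C"
  shows "Zero C X Y \<in> Arr C" "Dom C (Zero C X Y) = X" "Cod C (Zero C X Y) = Y"
proof -
  interpret G: comm_group "Hom_group C X Y" using assms by (rule Hom_comm_group)
  have "Zero C X Y \<in> Hom C X Y" using G.one_closed by (simp add: Hom_group_def)
  then show "Zero C X Y \<in> Arr C" "Dom C (Zero C X Y) = X" "Cod C (Zero C X Y) = Y"
    by (simp_all add: Hom_def)
qed

lemma parallelI: "f \<in> Arr C \<Longrightarrow> g \<in> Arr C \<Longrightarrow> Dom C g = Dom C f \<Longrightarrow> Cod C g = Cod C f \<Longrightarrow> parallel f g"
  by (simp add: parallel_def)

lemma add_rules:
  assumes "parallel f g"
  shows "f \<oplus> g \<in> Arr C" "Dom C (f \<oplus> g) = Dom C f" "Cod C (f \<oplus> g) = Cod C f"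
    "f \<ominus> g \<in> Arr C" "Dom C (f \<ominus> g) = Dom C f" "Cod C (f \<ominus> g) = Cod C f"
    "f \<oplus> g = g \<oplus> f" "(f \<ominus> g) \<oplus> g = f" "(f \<oplus> g) \<ominus> g = f"
    "f \<oplus> Zero C (Dom C f) (Cod C f) = f"
    "f \<ominus> f = Zero C (Dom C f) (Cod C f)"
proof -
  have fg: "f \<in> Arr C" "g \<in> Arr C" "parallel f f" "parallel f g" "parallel g f"
    using assms by (auto simp: parallel_def)
  note G = Add_group[OF fg(1)]
  interpret G: comm_group "Hom_group C (Dom C f) (Cod C f)" by (rule G)
  note c = G(3)[OF fg(4)] G(2)
  show fg': "f \<oplus> g \<in> Arr C" "Dom C (f \<oplus> g) = Dom C f" "Cod C (f \<oplus> g) = Cod C f"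
    using G(6)[OF G.m_closed[OF c(2) c(1)]] unfolding G(4) parallel_def by auto
  have i: "inv\<^bsub>Hom_group C (Dom C f) (Cod C f)\<^esub> g \<in> carrier (Hom_group C (Dom C f) (Cod C f))"
    using c by simp
  show "f \<ominus> g \<in> Arr C" "Dom C (f \<ominus> g) = Dom C f" "Cod C (f \<ominus> g) = Cod C f"
    using G(6)[OF G.m_closed[OF c(2) i]] unfolding G(4) parallel_def G(7)[OF c(1)] by auto
  show "f \<oplus> g = g \<oplus> f" using G.m_comm[OF c] unfolding G(4) by simp
  show "(f \<ominus> g) \<oplus> g = f" using G.m_assoc[OF c(2) i c(1)] G.l_inv[OF c(1)] G.r_one[OF c(2)]
    unfolding G(4) G(7)[OF c(1)] by simp
  have d: "Dom C (f \<oplus> g) = Dom C f" "Cod C (f \<oplus> g) = Cod C f" by fact+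
  show "(f \<oplus> g) \<ominus> g = f"
    using G.m_assoc[OF c(2) c(1) i] G.r_inv[OF c(1)] G.r_one[OF c(2)] fg unfolding G(4) by (simp add: Minus_def parallel_def)
  show "f \<oplus> Zero C (Dom C f) (Cod C f) = f" using G.r_one[OF c(2)] unfolding G(4) G(5) .
  show "f \<ominus> f = Zero C (Dom C f) (Cod C f)" unfolding G(7)[OF c(2)] using G.r_inv[OF c(2)] unfolding G(4) G(5) .
qed

lemma add_assoc:
  assumes "parallel f g" "parallel f h"
  shows "(f \<oplus> g) \<oplus> h = f \<oplus> (g \<oplus> h)"
proof -
  have fg: "f \<in> Arr C" using assms by (auto simp: parallel_def)
  note G = Add_group[OF fg]
  interpret G: comm_group "Hom_group C (Dom C f) (Cod C f)" by (rule G)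
  show ?thesis using G.m_assoc[OF G(2) G(3)[OF assms(1)] G(3)[OF assms(2)]] unfolding G(4) .
qed

lemma Add_typing [simp]:
  assumes "f \<in> Arr C" "g \<in> Arr C" "Dom C g = Dom C f" "Cod C g = Cod C f"
  shows "f \<oplus> g \<in> Arr C" "Dom C (f \<oplus> g) = Dom C f" "Cod C (f \<oplus> g) = Cod C f"
    "f \<ominus> g \<in> Arr C" "Dom C (f \<ominus> g) = Dom C f" "Cod C (f \<ominus> g) = Cod C f"
  using add_rules[OF parallelI[OF assms]] by auto

lemma add_commute:
  "f \<in> Arr C \<Longrightarrow> g \<in> Arr C \<Longrightarrow> Dom C g = Dom C f \<Longrightarrow> Cod C g = Cod C f \<Longrightarrow> f \<oplus> g = g \<oplus> f"
  by (rule add_rules(7)) (rule parallelI)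

lemma add_associative:
  "f \<in> Arr C \<Longrightarrow> g \<in> Arr C \<Longrightarrow> h \<in> Arr C \<Longrightarrow> Dom C g = Dom C f \<Longrightarrow> Cod C g = Cod C f \<Longrightarrow>
   Dom C h = Dom C f \<Longrightarrow> Cod C h = Cod C f \<Longrightarrow> (f \<oplus> g) \<oplus> h = f \<oplus> (g \<oplus> h)"
  by (rule add_assoc) (auto simp: parallel_def)

lemma add_left_commute:
  assumes "f \<in> Arr C" "g \<in> Arr C" "h \<in> Arr C" "Dom C g = Dom C f" "Cod C g = Cod C f"
   "Dom C h = Dom C f" "Cod C h = Cod C f"
 shows "f \<oplus> (g \<oplus> h) = g \<oplus> (f \<oplus> h)"
  using add_associative[of f g h] add_associative[of g f h] add_commute[of f g] assms by simp

lemma minus_eq_iff: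
  assumes "f \<in> Arr C" "g \<in> Arr C" "h \<in> Arr C" "Dom C g = Dom C f" "Cod C g = Cod C f"
   "Dom C h = Dom C f" "Cod C h = Cod C f"
 shows "f \<ominus> g = h \<longleftrightarrow> f = h \<oplus> g"
  using add_rules(8)[OF parallelI, of f g] add_rules(9)[OF parallelI, of h g] assms by metis

lemma minus_eq_iff':
  assumes "f \<in> Arr C" "g \<in> Arr C" "h \<in> Arr C" "Dom C g = Dom C f" "Cod C g = Cod C f"
   "Dom C h = Dom C f" "Cod C h = Cod C f"
 shows "h = f \<ominus> g \<longleftrightarrow> h \<oplus> g = f"
  using minus_eq_iff[OF assms] by metis

lemma add_right_cancel:
  assumes "f \<in> Arr C" "g \<in> Arr C" "h \<in> Arr C" "Dom C g = Dom C f" "Cod C g = Cod C f"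
   "Dom C h = Dom C f" "Cod C h = Cod C f" "f \<oplus> h = g \<oplus> h"
 shows "f = g"
  using add_rules(9)[OF parallelI, of f h] add_rules(9)[OF parallelI, of g h] assms by metis

lemma minus_add:
  assumes "f \<in> Arr C" "g \<in> Arr C" "Dom C g = Dom C f" "Cod C g = Cod C f"
  shows "(f \<ominus> g) \<oplus> g = f" "g \<oplus> (f \<ominus> g) = f"
proof -
  show "(f \<ominus> g) \<oplus> g = f" using add_rules(8)[OF parallelI[OF assms]] .
  then show "g \<oplus> (f \<ominus> g) = f" using assms by (subst add_commute) simp_all
qed

lemma minus_simps:
  assumes "f \<in> Arr C" "g \<in> Arr C" "h \<in> Arr C" "Dom C g = Dom C f" "Cod C g = Cod C f"
   "Dom C h = Dom C f" "Cod C h = Cod C f"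
 shows "f \<oplus> (g \<ominus> h) = (f \<oplus> g) \<ominus> h" "(f \<ominus> g) \<oplus> h = (f \<oplus> h) \<ominus> g"
   "(f \<ominus> g) \<ominus> h = f \<ominus> (g \<oplus> h)" "f \<ominus> (g \<ominus> h) = (f \<oplus> h) \<ominus> g"
proof -
  show "f \<oplus> (g \<ominus> h) = (f \<oplus> g) \<ominus> h"
    by (rule add_right_cancel[of _ _ h]) (use assms in \<open>simp_all add: minus_add add_associative\<close>)
  show "(f \<ominus> g) \<oplus> h = (f \<oplus> h) \<ominus> g"
    by (rule add_right_cancel[of _ _ g]) (use assms in \<open>simp_all add: minus_add add_associative add_commute[of h g] add_associative[of "f \<ominus> g" g h, symmetric]\<close>)
  have "((f \<ominus> g) \<ominus> h) \<oplus> (g \<oplus> h) = ((f \<ominus> g) \<ominus> h) \<oplus> h \<oplus> g"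
    using assms by (simp add: add_associative add_commute[of g h])
  also have "\<dots> = (f \<ominus> (g \<oplus> h)) \<oplus> (g \<oplus> h)"
    using assms by (simp add: minus_add)
  finally show "(f \<ominus> g) \<ominus> h = f \<ominus> (g \<oplus> h)"
    by (rule add_right_cancel[rotated -1]) (use assms in simp_all)
  show "f \<ominus> (g \<ominus> h) = (f \<oplus> h) \<ominus> g"
  proof (rule add_right_cancel[of _ _ g])
    have "(f \<ominus> (g \<ominus> h)) \<oplus> g = (f \<ominus> (g \<ominus> h)) \<oplus> ((g \<ominus> h) \<oplus> h)"
      using assms by (simp add: minus_add)
    also have "\<dots> = ((f \<ominus> (g \<ominus> h)) \<oplus> (g \<ominus> h)) \<oplus> h"
      using assms by (simp add: add_associative)
    finally show "(f \<ominus> (g \<ominus> h)) \<oplus> g = ((f \<oplus> h) \<ominus> g) \<oplus> g" using assms by (simp add: minus_add)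
  qed (use assms in simp_all)
qed

lemma zero_idem:
  assumes "f \<in> Arr C" "f \<oplus> f = f" "Dom C f = X" "Cod C f = Y"
  shows "f = Zero C X Y"
  using add_rules(9,11)[OF parallelI, of f f] assms by metis

lemma add_Zero [simp]:
  assumes "f \<in> Arr C" "Dom C f = X" "Cod C f = Y"
  shows "f \<oplus> Zero C X Y = f" "Zero C X Y \<oplus> f = f" "f \<ominus> f = Zero C X Y" "f \<ominus> Zero C X Y = f"
  using assms add_rules(10,11)[OF parallelI, of f f] add_commute[of "Zero C X Y" f]
  by (auto simp: minus_eq_iff)

lemma Comp_Add [simp]:
  assumes "f \<in> Arr C" "g \<in> Arr C" "Dom C g = Dom C f" "Cod C g = Cod C f" "h \<in> Arr C"
  shows "Dom C h = Cod C f \<Longrightarrow> h \<cdot> (f \<oplus> g) = h \<cdot> f \<oplus> h \<cdot> g"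
    "Cod C h = Dom C f \<Longrightarrow> (f \<oplus> g) \<cdot> h = f \<cdot> h \<oplus> g \<cdot> h"
  using assms by (auto intro: Comp_Add_left Comp_Add_right HomI)

lemma Comp_Zero [simp]:
  assumes "f \<in> Arr C" "X \<in> Obj C"
  shows "Dom C f = Y \<Longrightarrow> f \<cdot> Zero C X Y = Zero C X (Cod C f)"
    "Cod C f = Y \<Longrightarrow> Zero C Y X \<cdot> f = Zero C (Dom C f) X"
proof -
  show "f \<cdot> Zero C X Y = Zero C X (Cod C f)" if "Dom C f = Y"
    using assms that by (intro zero_idem) (auto simp flip: Comp_Add(1))
  show "Zero C Y X \<cdot> f = Zero C (Dom C f) X" if "Cod C f = Y"
    using assms that by (intro zero_idem) (auto simp flip: Comp_Add(2))
qed

lemma Comp_Minus [simp]: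
  assumes "f \<in> Arr C" "g \<in> Arr C" "Dom C g = Dom C f" "Cod C g = Cod C f" "h \<in> Arr C"
  shows "Dom C h = Cod C f \<Longrightarrow> h \<cdot> (f \<ominus> g) = h \<cdot> f \<ominus> h \<cdot> g"
    "Cod C h = Dom C f \<Longrightarrow> (f \<ominus> g) \<cdot> h = f \<cdot> h \<ominus> g \<cdot> h"
  using assms by (simp_all add: minus_eq_iff' Comp_Add[symmetric] minus_add del: Comp_Add)

text \<open>
  Together with the distributive laws these rules move all subtractions outwards and then across the
  equation, so that an identity of the free abelian group becomes one between sorted sums.
\<close>

lemmas arr_simps = minus_simps minus_eq_iff minus_eq_iff' add_associative add_commute add_left_commute

end

section \<open>Pushouts, kernels, cokernels and biproducts\<close>

context category
begin

lemma pushout_typing: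
  assumes "pushout_square C f g i j" "f \<in> Hom C X Y" "g \<in> Hom C X Z"
  shows "i \<in> Hom C Y (Cod C i)" "j \<in> Hom C Z (Cod C i)" "i \<cdot> f = j \<cdot> g"
  using assms by (auto simp: pushout_square_def Hom_def)

lemma pushout_induced:
  assumes "pushout_square C f g i j" "f \<in> Hom C X Y" "g \<in> Hom C X Z" "i \<in> Hom C Y W"
    "u \<in> Hom C Y Q" "v \<in> Hom C Z Q" "u \<cdot> f = v \<cdot> g"
  obtains w where "w \<in> Hom C W Q" "w \<cdot> i = u" "w \<cdot> j = v"
proof -
  have "\<exists>!w. w \<in> Hom C W Q \<and> w \<cdot> i = u \<and> w \<cdot> j = v"
    using assms HomD[OF assms(2)] HomD[OF assms(3)] HomD[OF assms(4)] HomD[OF assms(5)]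
    unfolding pushout_square_def by metis
  then show thesis using that by blast
qed

lemma pushout_eqI:
  assumes "pushout_square C f g i j" "f \<in> Hom C X Y" "g \<in> Hom C X Z" "i \<in> Hom C Y W"
    "w \<in> Hom C W Q" "w' \<in> Hom C W Q" "w \<cdot> i = w' \<cdot> i" "w \<cdot> j = w' \<cdot> j"
  shows "w = w'"
proof -
  note T [simp] = HomD[OF assms(2)] HomD[OF assms(3)] HomD[OF assms(4)] HomD[OF assms(5)]
    HomD[OF assms(6)]
  note P = pushout_typing[OF assms(1-3)]
  note [simp] = HomD[OF P(2)]
  have "w \<cdot> i \<in> Hom C (Cod C f) Q" "w \<cdot> j \<in> Hom C (Cod C g) Q" by (simp_all add: Hom_def)
  moreover have "(w \<cdot> i) \<cdot> f = (w \<cdot> j) \<cdot> g" using P(3) by simp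
  ultimately have "\<exists>!v. v \<in> Hom C (Cod C i) Q \<and> v \<cdot> i = w \<cdot> i \<and> v \<cdot> j = w \<cdot> j"
    using assms(1) T unfolding pushout_square_def by blast
  then show ?thesis using assms(5-8) HomD(3)[OF assms(4)] by metis
qed

lemma pushout_commute:
  assumes "pushout_square C f g i j"
  shows "pushout_square C g f j i"
proof -
  have "Cod C j = Cod C i" using assms by (simp add: pushout_square_def Hom_def)
  then show ?thesis using assms unfolding pushout_square_def by (auto simp: conj_commute)
qed

lemma pushout_squareI:
  assumes T: "f \<in> Hom C X Y" "g \<in> Hom C X Z" "i \<in> Hom C Y W" "j \<in> Hom C Z W"
    and comm: "i \<cdot> f = j \<cdot> g"
    and ex: "\<And>Q u v. u \<in> Hom C Y Q \<Longrightarrow> v \<in> Hom C Z Q \<Longrightarrow> u \<cdot> f = v \<cdot> g \<Longrightarrow>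
      \<exists>w \<in> Hom C W Q. w \<cdot> i = u \<and> w \<cdot> j = v"
    and un: "\<And>Q u v. u \<in> Hom C W Q \<Longrightarrow> v \<in> Hom C W Q \<Longrightarrow> u \<cdot> i = v \<cdot> i \<Longrightarrow> u \<cdot> j = v \<cdot> j \<Longrightarrow> u = v"
  shows "pushout_square C f g i j"
proof -
  have "\<exists>!w. w \<in> Hom C W Q \<and> w \<cdot> i = u \<and> w \<cdot> j = v"
    if "u \<in> Hom C Y Q" "v \<in> Hom C Z Q" "u \<cdot> f = v \<cdot> g" for Q u v
    using ex[OF that] un by metis
  then show ?thesis
    using HomD(1-3)[OF T(1)] HomD(1-3)[OF T(2)] HomD(3)[OF T(3)] T(3,4) comm
    unfolding pushout_square_def by metis
qed

lemma monicD:
  "monic C f \<Longrightarrow> f \<in> Hom C X Y \<Longrightarrow> u \<in> Hom C W X \<Longrightarrow> v \<in> Hom C W X \<Longrightarrow> f \<cdot> u = f \<cdot> v \<Longrightarrow> u = v"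
  using HomD(4)[of u W X] HomD(2)[of f X Y] unfolding monic_def by metis

end

context preadditive_category
begin

lemma kernel_lift:
  assumes "is_kernel C k f" "k \<in> Hom C K X" "f \<in> Hom C X Y" "u \<in> Hom C W X"
    "f \<cdot> u = Zero C W Y"
  obtains v where "v \<in> Hom C W K" "k \<cdot> v = u"
proof -
  have "\<exists>!v. v \<in> Hom C W K \<and> k \<cdot> v = u"
    using assms HomD[OF assms(2)] HomD[OF assms(3)] HomD[OF assms(4)] unfolding is_kernel_def by metis
  then show thesis using that by blast
qed

lemma cokernel_extend:
  assumes "is_cokernel C c f" "c \<in> Hom C Y Q" "f \<in> Hom C X Y" "u \<in> Hom C Y W"
    "u \<cdot> f = Zero C X W"
  obtains v where "v \<in> Hom C Q W" "v \<cdot> c = u"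
proof -
  have "\<exists>!v. v \<in> Hom C Q W \<and> v \<cdot> c = u"
    using assms HomD[OF assms(2)] HomD[OF assms(3)] HomD[OF assms(4)] unfolding is_cokernel_def by metis
  then show thesis using that by blast
qed

lemma cokernel_eqI:
  assumes "is_cokernel C c f" "c \<in> Hom C Y Q" "u \<in> Hom C Q W" "v \<in> Hom C Q W" "u \<cdot> c = v \<cdot> c"
  shows "u = v"
proof -
  note T [simp] = HomD[OF assms(2)] HomD[OF assms(3)] HomD[OF assms(4)]
  have f [simp]: "f \<in> Arr C" "Cod C f = Y" and z: "c \<cdot> f = Zero C (Dom C f) Q"
    using assms(1) by (auto simp: is_cokernel_def composable_def)
  have "u \<cdot> c \<in> Hom C (Cod C f) W" "(u \<cdot> c) \<cdot> f = Zero C (Dom C f) W"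
    using z by (simp_all add: Hom_def)
  then have "\<exists>!w. w \<in> Hom C (Cod C c) W \<and> w \<cdot> c = u \<cdot> c"
    using assms(1) T unfolding is_cokernel_def by blast
  then show ?thesis using assms(3-5) HomD(3)[OF assms(2)] by metis
qed

text \<open>In an abelian category every monic is a kernel, so this makes it the kernel of its cokernel.\<close>

lemma monic_is_kernel_of_cokernel:
  assumes "is_kernel C m g" "is_cokernel C c m"
  shows "is_kernel C m c"
proof -
  have mc: "composable C c m" "c \<cdot> m = Zero C (Dom C m) (Cod C c)"
    and mg: "composable C g m" "g \<cdot> m = Zero C (Dom C m) (Cod C g)"
    using assms by (auto simp: is_kernel_def is_cokernel_def)
  note [simp] = mc[unfolded composable_def] mg[unfolded composable_def]
  obtain g' where g': "g' \<in> Hom C (Cod C c) (Cod C g)" "g' \<cdot> c = g"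
    by (rule cokernel_extend[OF assms(2), of "Cod C m" "Cod C c" "Dom C m" g "Cod C g"])
      (simp_all add: Hom_def)
  note [simp] = HomD[OF g'(1)]
  show ?thesis unfolding is_kernel_def
  proof (intro conjI ballI impI)
    fix W u assume u: "W \<in> Obj C" "u \<in> Hom C W (Dom C c)" "c \<cdot> u = Zero C W (Cod C c)"
    note [simp] = HomD[OF u(2)]
    have "g \<cdot> u = g' \<cdot> (c \<cdot> u)" using g'(2) assoc[of u c g'] by simp
    then have "g \<cdot> u = Zero C W (Cod C g)" using u by simp
    then show "\<exists>!v. v \<in> Hom C W (Dom C m) \<and> m \<cdot> v = u"
      using assms(1) u unfolding is_kernel_def by simp
  qed (use mc in auto)
qed

lemma zero_object_arr:
  assumes "zero_object C Z"
  shows "f \<in> Hom C X Z \<Longrightarrow> f = Zero C X Z" "f \<in> Hom C Z X \<Longrightarrow> f = Zero C Z X"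
proof -
  have Z: "Z \<in> Obj C" using assms by (simp add: zero_object_def)
  show "f = Zero C X Z" if "f \<in> Hom C X Z"
    using HomD[OF that] assms that Z HomI[OF Zero_typing(1), of X Z]
    unfolding zero_object_def by auto
  show "f = Zero C Z X" if "f \<in> Hom C Z X"
    using HomD[OF that] assms that Z HomI[OF Zero_typing(1), of Z X]
    unfolding zero_object_def by auto
qed

lemma cokernel_zero:
  assumes "is_cokernel C c f" "f \<in> Hom C X Y" "c \<in> Hom C Y Q"
  shows "c \<cdot> f = Zero C X Q"
  using assms HomD(2)[OF assms(2)] HomD(3)[OF assms(3)] unfolding is_cokernel_def by metis

lemma cokernel_epic:
  assumes "is_cokernel C c f"
  shows "epic C c"
  unfolding epic_def
proof (intro conjI ballI impI)
  show c: "c \<in> Arr C" using assms by (simp add: is_cokernel_def composable_def)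
  fix W u v assume "u \<in> Hom C (Cod C c) W" "v \<in> Hom C (Cod C c) W" "u \<cdot> c = v \<cdot> c"
  then show "u = v" by (rule cokernel_eqI[OF assms HomI[OF c refl refl]])
qed

lemma is_cokernelI:
  assumes T: "f \<in> Hom C X Y" "c \<in> Hom C Y Q"
    and zero: "c \<cdot> f = Zero C X Q"
    and ex: "\<And>W u. u \<in> Hom C Y W \<Longrightarrow> u \<cdot> f = Zero C X W \<Longrightarrow> \<exists>v \<in> Hom C Q W. v \<cdot> c = u"
    and un: "\<And>W u v. u \<in> Hom C Q W \<Longrightarrow> v \<in> Hom C Q W \<Longrightarrow> u \<cdot> c = v \<cdot> c \<Longrightarrow> u = v"
  shows "is_cokernel C c f"
proof -
  have "\<exists>!v. v \<in> Hom C Q W \<and> v \<cdot> c = u" if "u \<in> Hom C Y W" "u \<cdot> f = Zero C X W" for W u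
    using ex[OF that] un by metis
  then show ?thesis
    using HomD(1-3)[OF T(1)] HomD(1-3)[OF T(2)] zero
    unfolding is_cokernel_def composable_def by metis
qed

text \<open>Identifies the quotients of cofiber sequences, which are pushouts over \<open>pt\<close>.\<close>

lemma cofiber_is_cokernel:
  assumes Z: "zero_object C pt" and f: "f \<in> Hom C X Y" and t: "t \<in> Hom C X pt"
    and po: "pushout_square C f t q s"
  shows "is_cokernel C q f"
proof -
  define Q where "Q = Cod C q"
  have q: "q \<in> Hom C Y Q" and s: "s \<in> Hom C pt Q" and comm: "q \<cdot> f = s \<cdot> t"
    using pushout_typing[OF po f t] by (simp_all add: Q_def)
  note [simp] = HomD[OF f] HomD[OF t] HomD[OF q] HomD[OF s]
  have t0: "t = Zero C X pt" using zero_object_arr(1)[OF Z t] .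
  show ?thesis
  proof (rule is_cokernelI[OF f q])
    show "q \<cdot> f = Zero C X Q" unfolding comm t0 by simp
    fix W u assume u: "u \<in> Hom C Y W" "u \<cdot> f = Zero C X W"
    note [simp] = HomD[OF u(1)]
    have "u \<cdot> f = Zero C pt W \<cdot> t" using u by simp
    moreover have "Zero C pt W \<in> Hom C pt W" by (simp add: Hom_def)
    ultimately show "\<exists>v \<in> Hom C Q W. v \<cdot> q = u"
      using pushout_induced[OF po f t q u(1)] by metis
  next
    fix W u v assume uv: "u \<in> Hom C Q W" "v \<in> Hom C Q W" "u \<cdot> q = v \<cdot> q"
    have "u \<cdot> s = v \<cdot> s"
      using zero_object_arr(2)[OF Z Comp_in_Hom[OF s uv(1)]]
        zero_object_arr(2)[OF Z Comp_in_Hom[OF s uv(2)]] by simp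
    then show "u = v" by (rule pushout_eqI[OF po f t q uv])
  qed
qed

end

context abelian_category
begin

text \<open>
  Multiplying \<open>i1 p1 + i2 p2 = 1\<close> by \<open>p1\<close> on the left and \<open>i2\<close> on the right gives
  \<open>p1 i2 + p1 i2 = p1 i2\<close>, which is why the mixed composites vanish.
\<close>

lemma biproduct:
  assumes "X \<in> Obj C" "Y \<in> Obj C"
  obtains S i1 i2 p1 p2 where
    "i1 \<in> Hom C X S" "i2 \<in> Hom C Y S" "p1 \<in> Hom C S X" "p2 \<in> Hom C S Y"
    "p1 \<cdot> i1 = Ident C X" "p2 \<cdot> i2 = Ident C Y"
    "p1 \<cdot> i2 = Zero C Y X" "p2 \<cdot> i1 = Zero C X Y"
    "(i1 \<cdot> p1) \<oplus> (i2 \<cdot> p2) = Ident C S"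
proof -
  obtain S i1 i2 p1 p2 where S: "S \<in> Obj C"
    "i1 \<in> Hom C X S" "i2 \<in> Hom C Y S" "p1 \<in> Hom C S X" "p2 \<in> Hom C S Y"
    and e: "p1 \<cdot> i1 = Ident C X" "p2 \<cdot> i2 = Ident C Y"
    "(i1 \<cdot> p1) \<oplus> (i2 \<cdot> p2) = Ident C S"
    using ex_biproduct[OF assms] unfolding is_biproduct_def by blast
  note [simp] = HomD[OF S(2)] HomD[OF S(3)] HomD[OF S(4)] HomD[OF S(5)]
  have "p1 \<cdot> i2 \<oplus> p1 \<cdot> i2 = p1 \<cdot> ((i1 \<cdot> p1 \<oplus> i2 \<cdot> p2) \<cdot> i2)"
    by (simp add: e(1,2) reassoc[OF e(1)])
  also have "\<dots> = p1 \<cdot> i2" by (simp add: e(3))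
  finally have z1: "p1 \<cdot> i2 = Zero C Y X" by (intro zero_idem) simp_all
  have "p2 \<cdot> i1 \<oplus> p2 \<cdot> i1 = p2 \<cdot> ((i1 \<cdot> p1 \<oplus> i2 \<cdot> p2) \<cdot> i1)"
    by (simp add: e(1,2) reassoc[OF e(2)])
  also have "\<dots> = p2 \<cdot> i1" by (simp add: e(3))
  finally have z2: "p2 \<cdot> i1 = Zero C X Y" by (intro zero_idem) simp_all
  show thesis using S e z1 z2 that by blast
qed

lemma biproduct_decompose:
  assumes "i1 \<in> Hom C X S" "i2 \<in> Hom C Y S" "p1 \<in> Hom C S X" "p2 \<in> Hom C S Y"
    "(i1 \<cdot> p1) \<oplus> (i2 \<cdot> p2) = Ident C S"
    "u \<in> Hom C S W"
  shows "u = (u \<cdot> i1) \<cdot> p1 \<oplus> (u \<cdot> i2) \<cdot> p2"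
proof -
  note [simp] = HomD[OF assms(1)] HomD[OF assms(2)] HomD[OF assms(3)] HomD[OF assms(4)]
  show ?thesis
    using HomD[OF assms(6)] assms(5) Comp_Add(1)[of "i1 \<cdot> p1" "i2 \<cdot> p2" u] by simp
qed

text \<open>The pushout is the cokernel of \<open>(f, -g) : X \<rightarrow> Y \<oplus> Z\<close>.\<close>

lemma ex_pushout_square:
  assumes "f \<in> Arr C" "g \<in> Arr C" "Dom C f = Dom C g"
  shows "\<exists>i j. pushout_square C f g i j"
proof -
  obtain S i1 i2 p1 p2 where S:
    "i1 \<in> Hom C (Cod C f) S" "i2 \<in> Hom C (Cod C g) S"
    "p1 \<in> Hom C S (Cod C f)" "p2 \<in> Hom C S (Cod C g)"
    and e: "p1 \<cdot> i1 = Ident C (Cod C f)" "p2 \<cdot> i2 = Ident C (Cod C g)"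
    "p1 \<cdot> i2 = Zero C (Cod C g) (Cod C f)" "p2 \<cdot> i1 = Zero C (Cod C f) (Cod C g)"
    "(i1 \<cdot> p1) \<oplus> (i2 \<cdot> p2) = Ident C S"
    using assms by (auto intro: biproduct[of "Cod C f" "Cod C g"])
  note [simp] = assms HomD[OF S(1)] HomD[OF S(2)] HomD[OF S(3)] HomD[OF S(4)]
  note es = e(1-4) reassoc[OF e(1)] reassoc[OF e(2)] reassoc[OF e(3)] reassoc[OF e(4)]
  define m where "m = i1 \<cdot> f \<ominus> i2 \<cdot> g"
  have m [simp]: "m \<in> Hom C (Dom C g) S" "m \<in> Arr C" "Dom C m = Dom C g" "Cod C m = S"
    by (simp_all add: m_def Hom_def)
  obtain c where c: "is_cokernel C c m" using ex_cokernel[of m] by auto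
  have [simp]: "c \<in> Arr C" "Dom C c = S" and cm: "c \<cdot> m = Zero C (Dom C g) (Cod C c)"
    using c by (auto simp: is_cokernel_def composable_def)
  have cH: "c \<in> Hom C S (Cod C c)" by (simp add: Hom_def)
  have comm: "c \<cdot> (i1 \<cdot> f) = c \<cdot> (i2 \<cdot> g)"
    using cm by (simp add: m_def minus_eq_iff)
  have "\<exists>!w. w \<in> Hom C (Cod C c) Q \<and> w \<cdot> (c \<cdot> i1) = u \<and> w \<cdot> (c \<cdot> i2) = v"
    if u: "u \<in> Hom C (Cod C f) Q" and v: "v \<in> Hom C (Cod C g) Q" and uv: "u \<cdot> f = v \<cdot> g"
    for u v Q
  proof -
    note [simp] = HomD[OF u] HomD[OF v]
    have "(u \<cdot> p1 \<oplus> v \<cdot> p2) \<cdot> m = Zero C (Dom C g) Q"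
      by (simp add: m_def es uv)
    then obtain w where w: "w \<in> Hom C (Cod C c) Q" "w \<cdot> c = u \<cdot> p1 \<oplus> v \<cdot> p2"
      by (auto intro: cokernel_extend[OF c cH m(1), of "u \<cdot> p1 \<oplus> v \<cdot> p2" Q] simp: Hom_def)
    note [simp] = HomD[OF w(1)]
    show ?thesis
    proof (intro ex1I conjI)
      have "w \<cdot> (c \<cdot> i1) = (w \<cdot> c) \<cdot> i1" "w \<cdot> (c \<cdot> i2) = (w \<cdot> c) \<cdot> i2" by simp_all
      then show "w \<cdot> (c \<cdot> i1) = u" "w \<cdot> (c \<cdot> i2) = v"
        unfolding w(2) by (simp_all add: es)
    next
      fix w' assume w': "w' \<in> Hom C (Cod C c) Q \<and> w' \<cdot> (c \<cdot> i1) = u \<and> w' \<cdot> (c \<cdot> i2) = v"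
      then have w'H: "w' \<in> Hom C (Cod C c) Q" by simp
      note [simp] = HomD[OF w'H]
      have "w' \<cdot> c = ((w' \<cdot> c) \<cdot> i1) \<cdot> p1 \<oplus> ((w' \<cdot> c) \<cdot> i2) \<cdot> p2"
        by (rule biproduct_decompose[OF S e(5), of _ Q]) (simp add: Hom_def)
      then have "w' \<cdot> c = u \<cdot> p1 \<oplus> v \<cdot> p2" using w' by simp
      then show "w' = w" using w(2) by (intro cokernel_eqI[OF c cH w'H w(1)]) simp
    qed (fact w(1))
  qed
  moreover have "c \<cdot> i1 \<in> Hom C (Cod C f) (Cod C (c \<cdot> i1))" "c \<cdot> i2 \<in> Hom C (Cod C g) (Cod C (c \<cdot> i1))"
    "(c \<cdot> i1) \<cdot> f = (c \<cdot> i2) \<cdot> g" "Cod C (c \<cdot> i1) = Cod C c"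
    using comm by (simp_all add: Hom_def)
  ultimately have "pushout_square C f g (c \<cdot> i1) (c \<cdot> i2)"
    unfolding pushout_square_def using assms by simp
  then show ?thesis by blast
qed

end

section \<open>Relative projectives, injectives and monics\<close>

context abelian_category
begin

lemma projective_lift:
  assumes "rel_projective C E P" "rel_epic C E c" "c \<in> Hom C Y Q" "u \<in> Hom C P Q"
  obtains v where "v \<in> Hom C P Y" "c \<cdot> v = u"
  using assms unfolding rel_projective_def by (auto simp: Hom_def)

lemma injective_extend:
  assumes "rel_injective C E I" "rel_monic C E f" "f \<in> Hom C X Y" "u \<in> Hom C X I"
  obtains v where "v \<in> Hom C Y I" "v \<cdot> f = u"
  using assms unfolding rel_injective_def by (auto simp: Hom_def)

text \<open>
  Lifting is defined through \<open>E\<close>-epics; an arbitrary cokernel of an \<open>E\<close>-monic differs from the one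
  witnessing membership in \<open>E\<close> by an isomorphism only.
\<close>

lemma projective_lift_cokernel:
  assumes E: "allowable_class C E" "rel_projective C E P"
    and f: "rel_monic C E f" "f \<in> Hom C X Y"
    and q: "is_cokernel C q f" "q \<in> Hom C Y Q"
    and u: "u \<in> Hom C P Q"
  obtains v where "v \<in> Hom C P Y" "q \<cdot> v = u"
proof -
  obtain c where c: "is_cokernel C c f" "(f, c) \<in> E" using f unfolding rel_monic_def by blast
  have k: "is_kernel C f c" using E(1) c(2) unfolding allowable_class_def short_exact_def by blast
  have cH: "c \<in> Hom C Y (Cod C c)"
    using c(1) f(2) by (auto simp: is_cokernel_def composable_def Hom_def)
  note [simp] = HomD(1,2)[OF cH] HomD[OF f(2)] HomD[OF q(2)] HomD[OF u]
  have "epic C c" by (rule cokernel_epic[OF c(1)])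
  then have ce: "rel_epic C E c" unfolding rel_epic_def using k c(2) by blast
  obtain a where a: "a \<in> Hom C Q (Cod C c)" "a \<cdot> q = c"
    by (rule cokernel_extend[OF q f(2) cH cokernel_zero[OF c(1) f(2) cH]])
  obtain b where b: "b \<in> Hom C (Cod C c) Q" "b \<cdot> c = q"
    by (rule cokernel_extend[OF c(1) cH f(2) q(2) cokernel_zero[OF q(1) f(2) q(2)]])
  note [simp] = HomD[OF a(1)] HomD[OF b(1)]
  have ba: "b \<cdot> a = Ident C Q"
    by (rule cokernel_eqI[OF q, of _ Q]) (simp_all add: Hom_def a b)
  have "a \<cdot> u \<in> Hom C P (Cod C c)" by (simp add: Hom_def)
  then obtain v where v: "v \<in> Hom C P Y" "c \<cdot> v = a \<cdot> u"
    by (rule projective_lift[OF E(2) ce cH])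
  note [simp] = HomD[OF v(1)]
  have "q \<cdot> v = b \<cdot> (c \<cdot> v)" using b(2) assoc[of v c b] by simp
  also have "\<dots> = u" unfolding v(2) by (simp add: reassoc[OF ba])
  finally show thesis using v that by blast
qed

lemma rel_monic_of_trivial_quotient:
  assumes E: "allowable_class C E"
    and k: "is_kernel C f c" "is_cokernel C c f" "zero_object C (Dom C f) \<or> zero_object C (Cod C c)"
    and m: "monic C f"
  shows "rel_monic C E f"
  using assms unfolding rel_monic_def allowable_class_def short_exact_def by blast

lemma iso_rel_monic:
  assumes E: "allowable_class C E" and f: "iso_arr C f"
  shows "rel_monic C E f"
proof -
  define X Y where "X = Dom C f" and "Y = Cod C f"
  have fH: "f \<in> Hom C X Y" using f by (simp add: iso_arr_def X_def Y_def Hom_def)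
  obtain g where g: "g \<in> Hom C Y X" "g \<cdot> f = Ident C X" "f \<cdot> g = Ident C Y"
    using f unfolding iso_arr_def X_def Y_def by blast
  obtain Z where Z: "zero_object C Z" using ex_zero_object by blast
  then have [simp]: "Z \<in> Obj C" by (simp add: zero_object_def)
  note [simp] = HomD[OF fH] HomD[OF g(1)]
  have left: "u = v" if "u \<in> Hom C W X" "v \<in> Hom C W X" "f \<cdot> u = f \<cdot> v" for u v W
  proof -
    have "g \<cdot> (f \<cdot> u) = u" "g \<cdot> (f \<cdot> v) = v"
      using HomD[OF that(1)] HomD[OF that(2)] by (simp_all add: reassoc[OF g(2)])
    then show ?thesis using that(3) by metis
  qed
  show ?thesis
  proof (rule rel_monic_of_trivial_quotient[OF E])
    show "monic C f" using left by (auto simp: monic_def)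
    show "is_kernel C f (Zero C Y Z)" unfolding is_kernel_def
    proof (intro conjI ballI impI)
      fix W u assume "W \<in> Obj C" "u \<in> Hom C W (Dom C (Zero C Y Z))"
      then have u: "u \<in> Hom C W Y" by simp
      note [simp] = HomD[OF u]
      have "g \<cdot> u \<in> Hom C W X" "f \<cdot> (g \<cdot> u) = u" by (simp_all add: Hom_def reassoc[OF g(3)])
      then show "\<exists>!v. v \<in> Hom C W (Dom C f) \<and> f \<cdot> v = u" using left by auto
    qed (auto simp: composable_def)
    show "is_cokernel C (Zero C Y Z) f" unfolding is_cokernel_def
    proof (intro conjI ballI impI)
      fix W u assume W: "W \<in> Obj C" and "u \<in> Hom C (Cod C f) W"
        and uf: "u \<cdot> f = Zero C (Dom C f) W"
      then have u: "u \<in> Hom C Y W" by simp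
      note [simp] = W HomD[OF u]
      have "(u \<cdot> f) \<cdot> g = u" by (simp add: g)
      then have "u = Zero C Y W" using uf by simp
      then show "\<exists>!v. v \<in> Hom C (Cod C (Zero C Y Z)) W \<and> v \<cdot> Zero C Y Z = u"
        using zero_object_arr(2)[OF Z] by (intro ex1I[of _ "Zero C Z W"]) (auto simp: Hom_def)
    qed (auto simp: composable_def)
    show "zero_object C (Dom C f) \<or> zero_object C (Cod C (Zero C Y Z))" using Z by simp
  qed
qed

lemma from_zero_object_rel_monic:
  assumes E: "allowable_class C E" and Z: "zero_object C Z" and f: "f \<in> Hom C Z X"
  shows "rel_monic C E f"
proof (rule rel_monic_of_trivial_quotient[OF E])
  note [simp] = HomD[OF f]
  have f0: "f = Zero C Z X" using zero_object_arr(2)[OF Z f] .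
  have uniq: "u = v" if "u \<in> Hom C W Z" "v \<in> Hom C W Z" for u v W
    using that zero_object_arr(1)[OF Z] by metis
  show "monic C f" using uniq by (auto simp: monic_def)
  show "zero_object C (Dom C f) \<or> zero_object C (Cod C (Ident C X))" using Z by simp
  show "is_kernel C f (Ident C X)" unfolding is_kernel_def
  proof (intro conjI ballI impI)
    fix W u assume W: "W \<in> Obj C" "u \<in> Hom C W (Dom C (Ident C X))"
      and "Ident C X \<cdot> u = Zero C W (Cod C (Ident C X))"
    then have "u = Zero C W X" by (simp add: Hom_def)
    then show "\<exists>!v. v \<in> Hom C W (Dom C f) \<and> f \<cdot> v = u"
      using W(1) uniq by (intro ex1I[of _ "Zero C W Z"]) (auto simp: Hom_def)
  qed (auto simp: composable_def f0)
  show "is_cokernel C (Ident C X) f" unfolding is_cokernel_def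
  proof (intro conjI ballI impI)
    fix W u assume W: "W \<in> Obj C" "u \<in> Hom C (Cod C f) W"
    then show "\<exists>!v. v \<in> Hom C (Cod C (Ident C X)) W \<and> v \<cdot> Ident C X = u"
      by (intro ex1I[of _ u]) (auto simp: Hom_def)
  qed (auto simp: composable_def f0)
qed

lemma zero_object_projective:
  assumes "zero_object C Z"
  shows "rel_projective C E Z"
  unfolding rel_projective_def
proof (intro conjI allI impI ballI)
  show Z: "Z \<in> Obj C" using assms by (simp add: zero_object_def)
  fix f x assume f: "rel_epic C E f" and x: "x \<in> Hom C Z (Cod C f)"
  then have "f \<in> Arr C" by (simp add: rel_epic_def epic_def)
  then show "\<exists>y\<in>Hom C Z (Dom C f). f \<cdot> y = x"
    using zero_object_arr(2)[OF assms x] Z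
    by (intro bexI[of _ "Zero C Z (Dom C f)"]) (auto simp: Hom_def)
qed

lemma biproduct_projective:
  assumes "rel_projective C E P" "rel_projective C E Q"
    and S: "i1 \<in> Hom C P S" "i2 \<in> Hom C Q S" "p1 \<in> Hom C S P" "p2 \<in> Hom C S Q"
    and e: "(i1 \<cdot> p1) \<oplus> (i2 \<cdot> p2) = Ident C S"
  shows "rel_projective C E S"
  unfolding rel_projective_def
proof (intro conjI allI impI ballI)
  note [simp] = HomD[OF S(1)] HomD[OF S(2)] HomD[OF S(3)] HomD[OF S(4)]
  show "S \<in> Obj C" by simp
  fix f x assume f: "rel_epic C E f" and x: "x \<in> Hom C S (Cod C f)"
  have fH: "f \<in> Hom C (Dom C f) (Cod C f)" using f by (simp add: rel_epic_def epic_def Hom_def)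
  note [simp] = HomD(1)[OF fH] HomD[OF x]
  obtain y1 where y1: "y1 \<in> Hom C P (Dom C f)" "f \<cdot> y1 = x \<cdot> i1"
    using projective_lift[OF assms(1) f fH Comp_in_Hom[OF S(1) x]] by metis
  obtain y2 where y2: "y2 \<in> Hom C Q (Dom C f)" "f \<cdot> y2 = x \<cdot> i2"
    using projective_lift[OF assms(2) f fH Comp_in_Hom[OF S(2) x]] by metis
  note [simp] = HomD[OF y1(1)] HomD[OF y2(1)]
  have "f \<cdot> (y1 \<cdot> p1 \<oplus> y2 \<cdot> p2) = (x \<cdot> i1) \<cdot> p1 \<oplus> (x \<cdot> i2) \<cdot> p2"
    by (simp add: reassoc[OF y1(2)] reassoc[OF y2(2)])
  also have "\<dots> = x" by (rule biproduct_decompose[OF S e x, symmetric])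
  finally have "f \<cdot> (y1 \<cdot> p1 \<oplus> y2 \<cdot> p2) = x" .
  moreover have "y1 \<cdot> p1 \<oplus> y2 \<cdot> p2 \<in> Hom C S (Dom C f)" by (simp add: Hom_def)
  ultimately show "\<exists>y\<in>Hom C S (Dom C f). f \<cdot> y = x" by blast
qed

section \<open>Stable equivalences\<close>

text \<open>The ideal modulo which stable equivalences are the invertible arrows.\<close>

definition null :: "('a \<times> 'a) set \<Rightarrow> 'a \<Rightarrow> bool" where
  "null E f \<longleftrightarrow> (\<exists>P a b. rel_projective C E P \<and> a \<in> Hom C (Dom C f) P \<and>
     b \<in> Hom C P (Cod C f) \<and> f = b \<cdot> a)"

lemma nullI:
  "rel_projective C E P \<Longrightarrow> a \<in> Hom C X P \<Longrightarrow> b \<in> Hom C P Y \<Longrightarrow> null E (b \<cdot> a)"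
  using HomD(2)[OF Comp_in_Hom] HomD(3)[OF Comp_in_Hom] unfolding null_def by metis

lemma nullE:
  assumes "null E f" "f \<in> Hom C X Y"
  obtains P a b where "rel_projective C E P" "a \<in> Hom C X P" "b \<in> Hom C P Y" "f = b \<cdot> a"
  using assms(1) that HomD(2,3)[OF assms(2)] unfolding null_def by metis

lemma null_compose:
  assumes "null E f" "f \<in> Arr C"
  shows "g \<in> Arr C \<Longrightarrow> Dom C g = Cod C f \<Longrightarrow> null E (g \<cdot> f)"
    "h \<in> Arr C \<Longrightarrow> Cod C h = Dom C f \<Longrightarrow> null E (f \<cdot> h)"
proof -
  obtain P a b where P: "rel_projective C E P" "a \<in> Hom C (Dom C f) P" "b \<in> Hom C P (Cod C f)"
    "f = b \<cdot> a"
    by (rule nullE[OF assms(1) HomI[OF assms(2) refl refl]])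
  note ab = HomD(1-3)[OF P(2)] HomD(1-3)[OF P(3)]
  show "null E (g \<cdot> f)" if g: "g \<in> Arr C" "Dom C g = Cod C f"
    using nullI[OF P(1,2) Comp_in_Hom[OF P(3) HomI[OF g refl]]] assoc[of a b g] g ab P(4) by metis
  show "null E (f \<cdot> h)" if h: "h \<in> Arr C" "Cod C h = Dom C f"
    using nullI[OF P(1) Comp_in_Hom[OF HomI[OF h(1) refl h(2)] P(2)] P(3)] assoc[of h a b] h ab P(4)
    by metis
qed

text \<open>If \<open>f\<close> factors through \<open>P\<close> and \<open>g\<close> through \<open>Q\<close>, then \<open>f + g\<close> factors through \<open>P \<oplus> Q\<close>.\<close>

lemma null_Add:
  assumes "null E f" "null E g" "f \<in> Arr C" "g \<in> Arr C" "Dom C g = Dom C f" "Cod C g = Cod C f"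
  shows "null E (f \<oplus> g)"
proof -
  define X Y where "X = Dom C f" and "Y = Cod C f"
  have fg: "f \<in> Hom C X Y" "g \<in> Hom C X Y" using assms by (auto simp: Hom_def X_def Y_def)
  obtain P a b where P: "rel_projective C E P" "a \<in> Hom C X P" "b \<in> Hom C P Y" "f = b \<cdot> a"
    by (rule nullE[OF assms(1) fg(1)])
  obtain Q c d where Q: "rel_projective C E Q" "c \<in> Hom C X Q" "d \<in> Hom C Q Y" "g = d \<cdot> c"
    by (rule nullE[OF assms(2) fg(2)])
  note [simp] = HomD[OF P(2)] HomD[OF P(3)] HomD[OF Q(2)] HomD[OF Q(3)]
  obtain S i1 i2 p1 p2 where S:
    "i1 \<in> Hom C P S" "i2 \<in> Hom C Q S" "p1 \<in> Hom C S P" "p2 \<in> Hom C S Q"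
    and e: "p1 \<cdot> i1 = Ident C P" "p2 \<cdot> i2 = Ident C Q"
    "p1 \<cdot> i2 = Zero C Q P" "p2 \<cdot> i1 = Zero C P Q"
    "(i1 \<cdot> p1) \<oplus> (i2 \<cdot> p2) = Ident C S"
    by (rule biproduct[of P Q]) simp_all
  note [simp] = HomD[OF S(1)] HomD[OF S(2)] HomD[OF S(3)] HomD[OF S(4)]
  have "null E ((b \<cdot> p1 \<oplus> d \<cdot> p2) \<cdot> (i1 \<cdot> a \<oplus> i2 \<cdot> c))"
    by (rule nullI[OF biproduct_projective[OF P(1) Q(1) S e(5)], of _ X _ Y])
      (simp_all add: Hom_def)
  then show ?thesis
    by (simp add: P(4) Q(4) reassoc[OF e(1)] reassoc[OF e(2)] reassoc[OF e(3)] reassoc[OF e(4)])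
qed

lemma null_Minus_swap:
  assumes "null E (f \<ominus> g)" "f \<in> Hom C X Y" "g \<in> Hom C X Y"
  shows "null E (g \<ominus> f)"
proof -
  note [simp] = HomD[OF assms(2)] HomD[OF assms(3)]
  obtain P a b where P: "rel_projective C E P" "a \<in> Hom C X P" "b \<in> Hom C P Y" "f \<ominus> g = b \<cdot> a"
    by (rule nullE[OF assms(1) HomI[of _ X Y]]) simp_all
  note [simp] = HomD[OF P(2)] HomD[OF P(3)]
  have "f = b \<cdot> a \<oplus> g" using P(4) by (simp add: minus_eq_iff)
  then have "g \<ominus> f = (Zero C P Y \<ominus> b) \<cdot> a"
    by (simp add: arr_simps)
  then show ?thesis using nullI[OF P(1,2), of "Zero C P Y \<ominus> b" Y] by (simp add: Hom_def)
qed

lemma stable_equivalence_iff: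
  assumes "f \<in> Hom C X Y"
  shows "stable_equivalence C E f \<longleftrightarrow> (\<exists>h \<in> Hom C Y X.
     null E (Ident C X \<ominus> h \<cdot> f) \<and> null E (Ident C Y \<ominus> f \<cdot> h))"
proof -
  note [simp] = HomD[OF assms]
  have *: "stably_equivalent C E u (Ident C W) \<longleftrightarrow> null E (Ident C W \<ominus> u)"
    if "u \<in> Hom C W W" for u W
  proof -
    note [simp] = HomD[OF that]
    have "stably_equivalent C E u (Ident C W) \<longleftrightarrow> null E (u \<ominus> Ident C W)"
      unfolding stably_equivalent_def null_def by auto
    also have "\<dots> \<longleftrightarrow> null E (Ident C W \<ominus> u)"
      using null_Minus_swap[of E u "Ident C W" W W] null_Minus_swap[of E "Ident C W" u W W] that
      by (auto simp: Hom_def)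
    finally show ?thesis .
  qed
  have "stable_equivalence C E f \<longleftrightarrow> (\<exists>h \<in> Hom C Y X.
     stably_equivalent C E (f \<cdot> h) (Ident C Y) \<and> stably_equivalent C E (h \<cdot> f) (Ident C X))"
    by (simp add: stable_equivalence_def)
  also have "\<dots> \<longleftrightarrow> (\<exists>h \<in> Hom C Y X.
     null E (Ident C X \<ominus> h \<cdot> f) \<and> null E (Ident C Y \<ominus> f \<cdot> h))"
    using * Comp_in_Hom[OF assms] Comp_in_Hom[OF _ assms] by metis
  finally show ?thesis .
qed

lemma stable_equivalenceE:
  assumes "stable_equivalence C E f" "f \<in> Hom C X Y"
  obtains h where "h \<in> Hom C Y X" "null E (Ident C X \<ominus> h \<cdot> f)" "null E (Ident C Y \<ominus> f \<cdot> h)"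
  using iffD1[OF stable_equivalence_iff[OF assms(2)] assms(1)] by blast

lemma stable_equivalenceI:
  assumes f: "f \<in> Hom C X Y" and h: "h \<in> Hom C Y X"
    and P: "rel_projective C E P" "a \<in> Hom C X P" "b \<in> Hom C P X" "h \<cdot> f \<oplus> b \<cdot> a = Ident C X"
    and Q: "rel_projective C E Q" "c \<in> Hom C Y Q" "d \<in> Hom C Q Y" "f \<cdot> h \<oplus> d \<cdot> c = Ident C Y"
  shows "stable_equivalence C E f"
proof -
  note [simp] = HomD[OF f] HomD[OF h] HomD[OF P(2)] HomD[OF P(3)] HomD[OF Q(2)] HomD[OF Q(3)]
  have "Ident C X \<ominus> h \<cdot> f = b \<cdot> a" "Ident C Y \<ominus> f \<cdot> h = d \<cdot> c"
    by (simp_all add: minus_eq_iff P(4)[symmetric] Q(4)[symmetric] add_commute)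
  then show ?thesis using stable_equivalence_iff[OF f] h nullI[OF P(1-3)] nullI[OF Q(1-3)] by metis
qed

lemma iso_stable_equivalence:
  assumes "iso_arr C f"
  shows "stable_equivalence C E f"
proof -
  define X Y where "X = Dom C f" and "Y = Cod C f"
  have f: "f \<in> Hom C X Y" using assms by (simp add: iso_arr_def X_def Y_def Hom_def)
  obtain g where g: "g \<in> Hom C Y X" "g \<cdot> f = Ident C X" "f \<cdot> g = Ident C Y"
    using assms unfolding iso_arr_def X_def Y_def by blast
  obtain Z where Z: "zero_object C Z" using ex_zero_object by blast
  then have [simp]: "Z \<in> Obj C" by (simp add: zero_object_def)
  note [simp] = HomD[OF f] HomD[OF g(1)]
  show ?thesis
    by (rule stable_equivalenceI[OF f g(1) zero_object_projective[OF Z] _ _ _ zero_object_projective[OF Z],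
      of "Zero C X Z" "Zero C Z X" "Zero C Y Z" "Zero C Z Y"]) (simp_all add: Hom_def g)
qed

text \<open>
  Modulo null maps, an inverse \<open>k\<close> of \<open>g f\<close> yields the inverse \<open>f k\<close> of \<open>g\<close> if \<open>f\<close> is invertible, and
  the inverse \<open>k g\<close> of \<open>f\<close> if \<open>g\<close> is.
\<close>

lemma stable_equivalence_cases:
  assumes f: "f \<in> Hom C X Y" and g: "g \<in> Hom C Y Z"
  shows "stable_equivalence C E f \<Longrightarrow> stable_equivalence C E g \<Longrightarrow> stable_equivalence C E (g \<cdot> f)"
    "stable_equivalence C E f \<Longrightarrow> stable_equivalence C E (g \<cdot> f) \<Longrightarrow> stable_equivalence C E g"
    "stable_equivalence C E g \<Longrightarrow> stable_equivalence C E (g \<cdot> f) \<Longrightarrow> stable_equivalence C E f"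
proof -
  note [simp] = HomD[OF f] HomD[OF g]
  note gf = Comp_in_Hom[OF f g]
  note iff = stable_equivalence_iff[OF f] stable_equivalence_iff[OF g] stable_equivalence_iff[OF gf]
  show "stable_equivalence C E (g \<cdot> f)" if w: "stable_equivalence C E f" "stable_equivalence C E g"
  proof -
    obtain h where h: "h \<in> Hom C Y X" "null E (Ident C X \<ominus> h \<cdot> f)" "null E (Ident C Y \<ominus> f \<cdot> h)"
      by (rule stable_equivalenceE[OF w(1) f])
    obtain k where k: "k \<in> Hom C Z Y" "null E (Ident C Y \<ominus> k \<cdot> g)" "null E (Ident C Z \<ominus> g \<cdot> k)"
      by (rule stable_equivalenceE[OF w(2) g])
    note [simp] = HomD[OF h(1)] HomD[OF k(1)]
    have "null E ((Ident C X \<ominus> h \<cdot> f) \<oplus> h \<cdot> ((Ident C Y \<ominus> k \<cdot> g) \<cdot> f))"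
      by (rule null_Add[OF h(2) null_compose(1)[OF null_compose(2)[OF k(2)]]])
        simp_all
    also have "(Ident C X \<ominus> h \<cdot> f) \<oplus> h \<cdot> ((Ident C Y \<ominus> k \<cdot> g) \<cdot> f)
        = Ident C X \<ominus> (h \<cdot> k) \<cdot> (g \<cdot> f)"
      by (simp add: arr_simps)
    finally have 1: "null E (Ident C X \<ominus> (h \<cdot> k) \<cdot> (g \<cdot> f))" .
    have "null E ((Ident C Z \<ominus> g \<cdot> k) \<oplus> g \<cdot> ((Ident C Y \<ominus> f \<cdot> h) \<cdot> k))"
      by (rule null_Add[OF k(3) null_compose(1)[OF null_compose(2)[OF h(3)]]])
        simp_all
    also have "(Ident C Z \<ominus> g \<cdot> k) \<oplus> g \<cdot> ((Ident C Y \<ominus> f \<cdot> h) \<cdot> k)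
        = Ident C Z \<ominus> (g \<cdot> f) \<cdot> (h \<cdot> k)"
      by (simp add: arr_simps)
    finally show ?thesis
      using 1 by (intro iffD2[OF iff(3)] bexI[OF _ Comp_in_Hom[OF k(1) h(1)]] conjI)
  qed
  show "stable_equivalence C E g" if w: "stable_equivalence C E f" "stable_equivalence C E (g \<cdot> f)"
  proof -
    obtain h where h: "h \<in> Hom C Y X" "null E (Ident C X \<ominus> h \<cdot> f)" "null E (Ident C Y \<ominus> f \<cdot> h)"
      by (rule stable_equivalenceE[OF w(1) f])
    obtain k where k: "k \<in> Hom C Z X" "null E (Ident C X \<ominus> k \<cdot> (g \<cdot> f))"
      "null E (Ident C Z \<ominus> (g \<cdot> f) \<cdot> k)"
      by (rule stable_equivalenceE[OF w(2) gf])
    note [simp] = HomD[OF h(1)] HomD[OF k(1)]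
    have "null E ((Ident C Y \<ominus> f \<cdot> (k \<cdot> g)) \<cdot> (Ident C Y \<ominus> f \<cdot> h) \<oplus>
        f \<cdot> ((Ident C X \<ominus> k \<cdot> (g \<cdot> f)) \<cdot> h))"
      by (rule null_Add[OF null_compose(1)[OF h(3)] null_compose(1)[OF null_compose(2)[OF k(2)]]])
        simp_all
    also have "(Ident C Y \<ominus> f \<cdot> (k \<cdot> g)) \<cdot> (Ident C Y \<ominus> f \<cdot> h) \<oplus>
        f \<cdot> ((Ident C X \<ominus> k \<cdot> (g \<cdot> f)) \<cdot> h) = Ident C Y \<ominus> (f \<cdot> k) \<cdot> g"
      by (simp add: arr_simps)
    finally have "null E (Ident C Y \<ominus> (f \<cdot> k) \<cdot> g)" .
    moreover have "null E (Ident C Z \<ominus> g \<cdot> (f \<cdot> k))" using k(3) by simp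
    ultimately show ?thesis by (intro iffD2[OF iff(2)] bexI[OF _ Comp_in_Hom[OF k(1) f]] conjI)
  qed
  show "stable_equivalence C E f" if w: "stable_equivalence C E g" "stable_equivalence C E (g \<cdot> f)"
  proof -
    obtain h where h: "h \<in> Hom C Z Y" "null E (Ident C Y \<ominus> h \<cdot> g)" "null E (Ident C Z \<ominus> g \<cdot> h)"
      by (rule stable_equivalenceE[OF w(1) g])
    obtain k where k: "k \<in> Hom C Z X" "null E (Ident C X \<ominus> k \<cdot> (g \<cdot> f))"
      "null E (Ident C Z \<ominus> (g \<cdot> f) \<cdot> k)"
      by (rule stable_equivalenceE[OF w(2) gf])
    note [simp] = HomD[OF h(1)] HomD[OF k(1)]
    have "null E ((Ident C Y \<ominus> h \<cdot> g) \<cdot> (Ident C Y \<ominus> f \<cdot> (k \<cdot> g)) \<oplus>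
        h \<cdot> ((Ident C Z \<ominus> (g \<cdot> f) \<cdot> k) \<cdot> g))"
      by (rule null_Add[OF null_compose(2)[OF h(2)] null_compose(1)[OF null_compose(2)[OF k(3)]]])
        simp_all
    also have "(Ident C Y \<ominus> h \<cdot> g) \<cdot> (Ident C Y \<ominus> f \<cdot> (k \<cdot> g)) \<oplus>
        h \<cdot> ((Ident C Z \<ominus> (g \<cdot> f) \<cdot> k) \<cdot> g) = Ident C Y \<ominus> f \<cdot> (k \<cdot> g)"
      by (simp add: arr_simps)
    finally have "null E (Ident C Y \<ominus> f \<cdot> (k \<cdot> g))" .
    moreover have "null E (Ident C X \<ominus> (k \<cdot> g) \<cdot> f)" using k(2) by simp
    ultimately show ?thesis by (intro iffD2[OF iff(1)] bexI[OF _ Comp_in_Hom[OF g k(1)]] conjI)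
  qed
qed

text \<open>
  With \<open>h x = 1 - b a\<close>, the map \<open>(x, a) : X \<rightarrow> X' \<oplus> P\<close> has the retraction \<open>(h, b)\<close>, so that
  \<open>e = 1 - (x, a) (h, b)\<close> is an idempotent killing \<open>(x, a)\<close>. Its first row \<open>(1 - x h, -x b)\<close> factors
  through a projective: if \<open>1 - x h = b\<^sub>0 a\<^sub>0\<close> through \<open>Q\<close>, it is \<open>b' \<alpha>\<close> with
  \<open>\<alpha> = a\<^sub>0 \<oplus> -1 : X' \<oplus> P \<rightarrow> Q \<oplus> P\<close> and \<open>b' = (b\<^sub>0, x b)\<close>. Put \<open>(a', -c) = \<alpha> e\<close>. Then
  \<open>\<alpha> e (x, a) = 0\<close> reads \<open>a' x = c a\<close>, and the first row of \<open>e = e e\<close> reads \<open>1 - x h = b' a'\<close> and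
  \<open>x b = b' c\<close>. The conditions are self-dual, which lets pushouts and pullbacks be treated alike.
\<close>

lemma coherent_inverse:
  assumes x: "x \<in> Hom C X X'" and w: "stable_equivalence C E x"
  obtains h P a b P' a' b' c where
    "h \<in> Hom C X' X"
    "rel_projective C E P" "a \<in> Hom C X P" "b \<in> Hom C P X"
    "rel_projective C E P'" "a' \<in> Hom C X' P'" "b' \<in> Hom C P' X'"
    "c \<in> Hom C P P'"
    "h \<cdot> x = Ident C X \<ominus> b \<cdot> a" "x \<cdot> h = Ident C X' \<ominus> b' \<cdot> a'"
    "a' \<cdot> x = c \<cdot> a" "x \<cdot> b = b' \<cdot> c"
proof -
  note [simp] = HomD[OF x]
  obtain h where h: "h \<in> Hom C X' X" and
    n: "null E (Ident C X \<ominus> h \<cdot> x)" "null E (Ident C X' \<ominus> x \<cdot> h)"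
    by (rule stable_equivalenceE[OF w x])
  note [simp] = HomD[OF h]
  obtain P a b where P: "rel_projective C E P" "a \<in> Hom C X P" "b \<in> Hom C P X"
      "Ident C X \<ominus> h \<cdot> x = b \<cdot> a"
    by (rule nullE[OF n(1) HomI[of _ X X]]) simp_all
  obtain Q a0 b0 where Q: "rel_projective C E Q" "a0 \<in> Hom C X' Q" "b0 \<in> Hom C Q X'"
      "Ident C X' \<ominus> x \<cdot> h = b0 \<cdot> a0"
    by (rule nullE[OF n(2) HomI[of _ X' X']]) simp_all
  note [simp] = HomD[OF P(2)] HomD[OF P(3)] HomD[OF Q(2)] HomD[OF Q(3)]
  have hx: "h \<cdot> x = Ident C X \<ominus> b \<cdot> a"
    using P(4) by (simp add: minus_eq_iff minus_eq_iff' add_commute)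
  have ba: "b0 \<cdot> a0 = Ident C X' \<ominus> x \<cdot> h" using Q(4) by simp
  obtain S i1 i2 p1 p2 where S:
    "i1 \<in> Hom C Q S" "i2 \<in> Hom C P S" "p1 \<in> Hom C S Q" "p2 \<in> Hom C S P"
    and e: "p1 \<cdot> i1 = Ident C Q" "p2 \<cdot> i2 = Ident C P"
    "p1 \<cdot> i2 = Zero C P Q" "p2 \<cdot> i1 = Zero C Q P"
    "(i1 \<cdot> p1) \<oplus> (i2 \<cdot> p2) = Ident C S"
    by (rule biproduct[of Q P]) simp_all
  note [simp] = HomD[OF S(1)] HomD[OF S(2)] HomD[OF S(3)] HomD[OF S(4)]
  note r = hx reassoc[OF hx] ba reassoc[OF ba] e(1-4) reassoc[OF e(1)] reassoc[OF e(2)]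
    reassoc[OF e(3)] reassoc[OF e(4)]
  define a' where "a' = i1 \<cdot> (a0 \<cdot> (Ident C X' \<ominus> x \<cdot> h)) \<oplus> i2 \<cdot> (a \<cdot> h)"
  define b' where "b' = b0 \<cdot> p1 \<oplus> x \<cdot> (b \<cdot> p2)"
  define c where "c = i1 \<cdot> (a0 \<cdot> (x \<cdot> b)) \<oplus> i2 \<cdot> (Ident C P \<ominus> a \<cdot> b)"
  show thesis
  proof
    show "rel_projective C E P" by fact
    show "rel_projective C E S" by (rule biproduct_projective[OF Q(1) P(1) S e(5)])
    show "h \<cdot> x = Ident C X \<ominus> b \<cdot> a" by fact
    show "x \<cdot> h = Ident C X' \<ominus> b' \<cdot> a'"
      by (simp add: a'_def b'_def r arr_simps)
    show "a' \<cdot> x = c \<cdot> a"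
      by (simp add: a'_def c_def r arr_simps)
    show "x \<cdot> b = b' \<cdot> c"
      by (simp add: b'_def c_def r arr_simps)
  qed (simp_all add: h P(2,3) a'_def b'_def c_def Hom_def)
qed

end

section \<open>Composites and pushouts of relative monics\<close>

locale relative_injectives = abelian_category C
  for C :: "('o, 'a, 'z) add_cat_scheme" (structure) and E :: "('a \<times> 'a) set" +
  assumes allowable: "allowable_class C E"
    and retractile: "retractile_monics C E"
    and enough_inj: "enough_injectives C E"
begin

lemma rel_monic_left_factor:
  assumes "f \<in> Hom C X Y" "y \<in> Hom C Y I" "rel_monic C E (y \<cdot> f)"
  shows "rel_monic C E f"
proof -
  have "composable C y f" using HomD[OF assms(1)] HomD[OF assms(2)] by (simp add: composable_def)
  then show ?thesis using retractile assms(3) unfolding retractile_monics_def by blast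
qed

lemma rel_monic_typing: "rel_monic C E f \<Longrightarrow> f \<in> Hom C (Dom C f) (Cod C f)"
  by (simp add: rel_monic_def monic_def Hom_def)

lemma embedding:
  assumes "X \<in> Obj C"
  obtains I m where "rel_injective C E I" "m \<in> Hom C X I" "rel_monic C E m"
  using enough_inj assms unfolding enough_injectives_def by metis

text \<open>
  Both closure properties hold because an embedding of the source into an \<open>E\<close>-injective object extends
  along the map in question, which is then \<open>E\<close>-monic as the first factor of an \<open>E\<close>-monic.
\<close>

lemma rel_monic_comp:
  assumes f: "f \<in> Hom C X Y" "rel_monic C E f" and g: "g \<in> Hom C Y Z" "rel_monic C E g"
  shows "rel_monic C E (g \<cdot> f)"
proof -
  obtain I m where I: "rel_injective C E I" and m: "m \<in> Hom C X I" "rel_monic C E m"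
    by (rule embedding[OF HomD(4)[OF f(1)]])
  obtain u where u: "u \<in> Hom C Y I" "u \<cdot> f = m"
    by (rule injective_extend[OF I f(2,1) m(1)])
  obtain v where v: "v \<in> Hom C Z I" "v \<cdot> g = u"
    by (rule injective_extend[OF I g(2,1) u(1)])
  have "v \<cdot> (g \<cdot> f) = m" using Comp_assoc[OF f(1) g(1) v(1)] u v by metis
  then show ?thesis using rel_monic_left_factor[OF Comp_in_Hom[OF f(1) g(1)] v(1)] m(2) by metis
qed

lemma pushout_rel_monic:
  assumes po: "pushout_square C f g i j" and f: "f \<in> Hom C X Y" and g: "g \<in> Hom C X Z"
    and m: "rel_monic C E g"
  shows "rel_monic C E i"
proof -
  note T = pushout_typing[OF po f g]
  obtain I m where I: "rel_injective C E I" and m': "m \<in> Hom C Y I" "rel_monic C E m"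
    by (rule embedding[OF HomD(5)[OF f]])
  obtain n where n: "n \<in> Hom C Z I" "n \<cdot> g = m \<cdot> f"
    by (rule injective_extend[OF I m g Comp_in_Hom[OF f m'(1)]])
  obtain w where w: "w \<in> Hom C (Cod C i) I" "w \<cdot> i = m" "w \<cdot> j = n"
    by (rule pushout_induced[OF po f g T(1) m'(1) n(1) n(2)[symmetric]])
  show ?thesis using rel_monic_left_factor[OF T(1) w(1)] w(2) m'(2) by metis
qed

end

section \<open>Pushouts and pullbacks of stable equivalences\<close>

locale relative_stable = relative_injectives +
  assumes projective_injective: "rel_projective C E X \<Longrightarrow> rel_injective C E X"
begin

text \<open>
  If \<open>t\<close> extends \<open>a\<close> along \<open>f\<close>, then \<open>1 - f b t\<close> and \<open>f h\<close> agree on \<open>X\<close> and define a candidate inverse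
  \<open>s\<close> of \<open>j\<close> on the pushout. The error \<open>1 - j s\<close> is \<open>k x b t\<close> on \<open>Y\<close> and \<open>k b' a'\<close> on \<open>X'\<close>. Since
  \<open>x b = b' c\<close> both are \<open>k b'\<close> after \<open>c t\<close> and \<open>a'\<close> respectively, and since \<open>a' x = c a\<close> those two glue
  to a map to \<open>P'\<close>.
\<close>

lemma pushout_stable_equivalence:
  assumes f: "f \<in> Hom C X Y" "rel_monic C E f"
    and x: "x \<in> Hom C X X'" "stable_equivalence C E x"
    and po: "pushout_square C f x j k"
  shows "stable_equivalence C E j"
proof -
  define W where "W = Cod C j"
  have j: "j \<in> Hom C Y W" and k: "k \<in> Hom C X' W" and jf: "j \<cdot> f = k \<cdot> x"
    using pushout_typing[OF po f(1) x(1)] by (simp_all add: W_def)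
  note [simp] = HomD[OF f(1)] HomD[OF x(1)] HomD[OF j] HomD[OF k]
  obtain h P a b P' a' b' c where h: "h \<in> Hom C X' X"
    and P: "rel_projective C E P" "a \<in> Hom C X P" "b \<in> Hom C P X"
    and P': "rel_projective C E P'" "a' \<in> Hom C X' P'" "b' \<in> Hom C P' X'"
    and c: "c \<in> Hom C P P'"
    and e: "h \<cdot> x = Ident C X \<ominus> b \<cdot> a" "x \<cdot> h = Ident C X' \<ominus> b' \<cdot> a'"
    "a' \<cdot> x = c \<cdot> a" "x \<cdot> b = b' \<cdot> c"
    by (rule coherent_inverse[OF x])
  note [simp] = HomD[OF h] HomD[OF P(2)] HomD[OF P(3)] HomD[OF P'(2)] HomD[OF P'(3)] HomD[OF c]
  obtain t where t: "t \<in> Hom C Y P" "t \<cdot> f = a"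
    by (rule injective_extend[OF projective_injective[OF P(1)] f(2,1) P(2)])
  note [simp] = HomD[OF t(1)]
  note r = e t(2) jf
  note r = r reassoc[OF r(1)] reassoc[OF r(2)] reassoc[OF r(3)] reassoc[OF r(4)] reassoc[OF r(5)]
    reassoc[OF r(6)]
  have "(Ident C Y \<ominus> f \<cdot> (b \<cdot> t)) \<cdot> f = (f \<cdot> h) \<cdot> x" "(c \<cdot> t) \<cdot> f = a' \<cdot> x"
    by (simp_all add: r)
  moreover have "Ident C Y \<ominus> f \<cdot> (b \<cdot> t) \<in> Hom C Y Y" "f \<cdot> h \<in> Hom C X' Y" "c \<cdot> t \<in> Hom C Y P'"
    by (simp_all add: Hom_def)
  ultimately obtain s A where s: "s \<in> Hom C W Y" "s \<cdot> j = Ident C Y \<ominus> f \<cdot> (b \<cdot> t)" "s \<cdot> k = f \<cdot> h"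
    and A: "A \<in> Hom C W P'" "A \<cdot> j = c \<cdot> t" "A \<cdot> k = a'"
    using pushout_induced[OF po f(1) x(1) j] P'(2) by metis
  note [simp] = HomD[OF s(1)] HomD[OF A(1)]
  note r = r s(2,3) A(2,3) reassoc[OF s(2)] reassoc[OF s(3)] reassoc[OF A(2)] reassoc[OF A(3)]
  show ?thesis
  proof (rule stable_equivalenceI[OF j s(1) P(1) t(1) _ _ P'(1) A(1)])
    show "f \<cdot> b \<in> Hom C P Y" "k \<cdot> b' \<in> Hom C P' W" by (simp_all add: Hom_def)
    show "s \<cdot> j \<oplus> f \<cdot> b \<cdot> t = Ident C Y" by (simp add: r arr_simps)
    show "j \<cdot> s \<oplus> k \<cdot> b' \<cdot> A = Ident C W"
    proof (rule pushout_eqI[OF po f(1) x(1) j])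
      show "(j \<cdot> s \<oplus> k \<cdot> b' \<cdot> A) \<cdot> j = Ident C W \<cdot> j"
        "(j \<cdot> s \<oplus> k \<cdot> b' \<cdot> A) \<cdot> k = Ident C W \<cdot> k"
        by (simp_all add: r arr_simps)
    qed (simp_all add: Hom_def)
  qed
qed

text \<open>
  The dual argument: \<open>b'\<close> lifts to \<open>t\<close>, the maps \<open>1 - t a' q\<close> and \<open>h q\<close> induce the inverse into the
  pullback, and \<open>t c\<close> and \<open>b\<close> induce the map through which the error factors.
\<close>

lemma pullback_stable_equivalence:
  assumes z: "z \<in> Hom C Z Z'" "stable_equivalence C E z"
    and q: "q \<in> Hom C Y' Z'"
    and lift: "\<And>P u. rel_projective C E P \<Longrightarrow> u \<in> Hom C P Z' \<Longrightarrow> \<exists>v \<in> Hom C P Y'. q \<cdot> v = u"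
    and p: "p \<in> Hom C W Y'" and p': "p' \<in> Hom C W Z" and comm: "q \<cdot> p = z \<cdot> p'"
    and ex: "\<And>A u v. u \<in> Hom C A Y' \<Longrightarrow> v \<in> Hom C A Z \<Longrightarrow> q \<cdot> u = z \<cdot> v \<Longrightarrow>
      \<exists>w \<in> Hom C A W. p \<cdot> w = u \<and> p' \<cdot> w = v"
    and un: "\<And>A u v. u \<in> Hom C A W \<Longrightarrow> v \<in> Hom C A W \<Longrightarrow> p \<cdot> u = p \<cdot> v \<Longrightarrow> p' \<cdot> u = p' \<cdot> v \<Longrightarrow> u = v"
  shows "stable_equivalence C E p"
proof -
  note [simp] = HomD[OF z(1)] HomD[OF q] HomD[OF p] HomD[OF p']
  obtain h P a b P' a' b' c where h: "h \<in> Hom C Z' Z"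
    and P: "rel_projective C E P" "a \<in> Hom C Z P" "b \<in> Hom C P Z"
    and P': "rel_projective C E P'" "a' \<in> Hom C Z' P'" "b' \<in> Hom C P' Z'"
    and c: "c \<in> Hom C P P'"
    and e: "h \<cdot> z = Ident C Z \<ominus> b \<cdot> a" "z \<cdot> h = Ident C Z' \<ominus> b' \<cdot> a'"
    "a' \<cdot> z = c \<cdot> a" "z \<cdot> b = b' \<cdot> c"
    by (rule coherent_inverse[OF z])
  note [simp] = HomD[OF h] HomD[OF P(2)] HomD[OF P(3)] HomD[OF P'(2)] HomD[OF P'(3)] HomD[OF c]
  obtain t where t: "t \<in> Hom C P' Y'" "q \<cdot> t = b'" using lift[OF P'(1,3)] by blast
  note [simp] = HomD[OF t(1)]
  note r = e t(2) comm
  note r = r reassoc[OF r(1)] reassoc[OF r(2)] reassoc[OF r(3)] reassoc[OF r(4)] reassoc[OF r(5)]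
    reassoc[OF r(6)]
  have "q \<cdot> (Ident C Y' \<ominus> t \<cdot> (a' \<cdot> q)) = z \<cdot> (h \<cdot> q)" "q \<cdot> (t \<cdot> c) = z \<cdot> b"
    by (simp_all add: r)
  moreover have "Ident C Y' \<ominus> t \<cdot> (a' \<cdot> q) \<in> Hom C Y' Y'" "h \<cdot> q \<in> Hom C Y' Z" "t \<cdot> c \<in> Hom C P Y'"
    by (simp_all add: Hom_def)
  ultimately obtain s B where
    s: "s \<in> Hom C Y' W" "p \<cdot> s = Ident C Y' \<ominus> t \<cdot> (a' \<cdot> q)" "p' \<cdot> s = h \<cdot> q"
    and B: "B \<in> Hom C P W" "p \<cdot> B = t \<cdot> c" "p' \<cdot> B = b"
    using ex P(3) by metis
  note [simp] = HomD[OF s(1)] HomD[OF B(1)]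
  note r = r s(2,3) B(2,3) reassoc[OF s(2)] reassoc[OF s(3)] reassoc[OF B(2)] reassoc[OF B(3)]
  show ?thesis
  proof (rule stable_equivalenceI[OF p s(1) P(1) _ B(1) _ P'(1) _ t(1)])
    show "a \<cdot> p' \<in> Hom C W P" "a' \<cdot> q \<in> Hom C Y' P'" by (simp_all add: Hom_def)
    show "p \<cdot> s \<oplus> t \<cdot> (a' \<cdot> q) = Ident C Y'" by (simp add: r arr_simps)
    show "s \<cdot> p \<oplus> B \<cdot> (a \<cdot> p') = Ident C W"
    proof (rule un)
      show "p \<cdot> (s \<cdot> p \<oplus> B \<cdot> (a \<cdot> p')) = p \<cdot> Ident C W"
        "p' \<cdot> (s \<cdot> p \<oplus> B \<cdot> (a \<cdot> p')) = p' \<cdot> Ident C W"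
        by (simp_all add: r arr_simps)
    qed (simp_all add: Hom_def)
  qed
qed

text \<open>
  An inverse of \<open>t\<close> descends to the pushouts if it is a map under \<open>X\<close> whose error terms factor through
  maps that vanish on \<open>X\<close>. Given a coherent inverse \<open>h\<close>, extend \<open>a f\<close> along \<open>f'\<close> to \<open>r : Y' \<rightarrow> P\<close> and
  replace \<open>h\<close> by \<open>k = h + b r\<close>. Then \<open>k f' = f\<close>, the error \<open>1 - k t\<close> is \<open>b (a - r t)\<close>, and coherence turns
  \<open>1 - t k\<close> into \<open>b' (a' - c r)\<close>; both bracketed maps vanish on \<open>X\<close>.
\<close>

lemma pushout_stable_equivalence_under:
  assumes f: "f \<in> Hom C X Y" and f': "f' \<in> Hom C X Y'" "rel_monic C E f'"
    and t: "t \<in> Hom C Y Y'" "stable_equivalence C E t" and tf: "t \<cdot> f = f'"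
    and g: "g \<in> Hom C X Z"
    and po: "pushout_square C f g i j" and po': "pushout_square C f' g i' j'"
    and i: "i \<in> Hom C Y W" and i': "i' \<in> Hom C Y' W'"
    and w: "w \<in> Hom C W W'" "w \<cdot> i = i' \<cdot> t" "w \<cdot> j = j'"
  shows "stable_equivalence C E w"
proof -
  have j: "j \<in> Hom C Z W" and comm: "i \<cdot> f = j \<cdot> g"
    using pushout_typing[OF po f g] HomD(3)[OF i] by simp_all
  have j': "j' \<in> Hom C Z W'" and comm': "i' \<cdot> f' = j' \<cdot> g"
    using pushout_typing[OF po' f'(1) g] HomD(3)[OF i'] by simp_all
  note [simp] = HomD[OF f] HomD[OF f'(1)] HomD[OF t(1)] HomD[OF g] HomD[OF i] HomD[OF i']
    HomD[OF w(1)] HomD[OF j] HomD[OF j']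
  obtain h P a b P' a' b' c where h: "h \<in> Hom C Y' Y"
    and P: "rel_projective C E P" "a \<in> Hom C Y P" "b \<in> Hom C P Y"
    and P': "rel_projective C E P'" "a' \<in> Hom C Y' P'" "b' \<in> Hom C P' Y'"
    and c: "c \<in> Hom C P P'"
    and e: "h \<cdot> t = Ident C Y \<ominus> b \<cdot> a" "t \<cdot> h = Ident C Y' \<ominus> b' \<cdot> a'"
    "a' \<cdot> t = c \<cdot> a" "t \<cdot> b = b' \<cdot> c"
    by (rule coherent_inverse[OF t])
  note [simp] = HomD[OF h] HomD[OF P(2)] HomD[OF P(3)] HomD[OF P'(2)] HomD[OF P'(3)] HomD[OF c]
  obtain r where r: "r \<in> Hom C Y' P" "r \<cdot> f' = a \<cdot> f"
    by (rule injective_extend[OF projective_injective[OF P(1)] f'(2,1) Comp_in_Hom[OF f P(2)]])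
  note [simp] = HomD[OF r(1)]
  have hf: "h \<cdot> f' = f \<ominus> b \<cdot> (a \<cdot> f)"
    unfolding tf[symmetric] by (simp add: reassoc[OF e(1)])
  have af: "a' \<cdot> f' = c \<cdot> (a \<cdot> f)"
    unfolding tf[symmetric] by (simp add: reassoc[OF e(3)])
  define k where "k = h \<oplus> b \<cdot> r"
  have k: "k \<in> Hom C Y' Y" by (simp add: k_def Hom_def)
  have "k \<cdot> f' = f" by (simp add: k_def hf r arr_simps)
  then have ik: "(i \<cdot> k) \<cdot> f' = j \<cdot> g" using HomD[OF k] comm by simp
  have z: "(a \<ominus> r \<cdot> t) \<cdot> f = Zero C Z P \<cdot> g" "(a' \<ominus> c \<cdot> r) \<cdot> f' = Zero C Z P' \<cdot> g"
    by (simp_all add: tf r af)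
  have H: "a \<ominus> r \<cdot> t \<in> Hom C Y P" "Zero C Z P \<in> Hom C Z P"
    "a' \<ominus> c \<cdot> r \<in> Hom C Y' P'" "Zero C Z P' \<in> Hom C Z P'"
    by (simp_all add: Hom_def)
  obtain s where s: "s \<in> Hom C W' W" "s \<cdot> i' = i \<cdot> k" "s \<cdot> j' = j"
    by (rule pushout_induced[OF po' f'(1) g i' Comp_in_Hom[OF k i] j ik])
  obtain A where A: "A \<in> Hom C W P" "A \<cdot> i = a \<ominus> r \<cdot> t" "A \<cdot> j = Zero C Z P"
    by (rule pushout_induced[OF po f g i H(1,2) z(1)])
  obtain A' where A': "A' \<in> Hom C W' P'" "A' \<cdot> i' = a' \<ominus> c \<cdot> r" "A' \<cdot> j' = Zero C Z P'"
    by (rule pushout_induced[OF po' f'(1) g i' H(3,4) z(2)])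
  note [simp] = HomD[OF s(1)] HomD[OF A(1)] HomD[OF A'(1)]
  note R = e s(2,3) A(2,3) A'(2,3) w(2,3)
  note R = R reassoc[OF R(1)] reassoc[OF R(2)] reassoc[OF R(3)] reassoc[OF R(4)] reassoc[OF R(5)]
    reassoc[OF R(6)] reassoc[OF R(7)] reassoc[OF R(8)] reassoc[OF R(9)] reassoc[OF R(10)]
    reassoc[OF R(11)] reassoc[OF R(12)]
  show ?thesis
  proof (rule stable_equivalenceI[OF w(1) s(1) P(1) A(1) _ _ P'(1) A'(1)])
    show "i \<cdot> b \<in> Hom C P W" "i' \<cdot> b' \<in> Hom C P' W'" by (simp_all add: Hom_def)
    show "s \<cdot> w \<oplus> i \<cdot> b \<cdot> A = Ident C W"
    proof (rule pushout_eqI[OF po f g i])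
      show "(s \<cdot> w \<oplus> i \<cdot> b \<cdot> A) \<cdot> i = Ident C W \<cdot> i" "(s \<cdot> w \<oplus> i \<cdot> b \<cdot> A) \<cdot> j = Ident C W \<cdot> j"
        by (simp_all add: R k_def arr_simps)
    qed (simp_all add: Hom_def)
    show "w \<cdot> s \<oplus> i' \<cdot> b' \<cdot> A' = Ident C W'"
    proof (rule pushout_eqI[OF po' f'(1) g i'])
      show "(w \<cdot> s \<oplus> i' \<cdot> b' \<cdot> A') \<cdot> i' = Ident C W' \<cdot> i'"
        "(w \<cdot> s \<oplus> i' \<cdot> b' \<cdot> A') \<cdot> j' = Ident C W' \<cdot> j'"
        by (simp_all add: R k_def arr_simps)
    qed (simp_all add: Hom_def)
  qed
qed

end

section \<open>Gluing and extension\<close>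

context relative_stable
begin

lemma ex_pushout:
  assumes "f \<in> Hom C X Y" "g \<in> Hom C X Z"
  obtains i j W where "pushout_square C f g i j" "i \<in> Hom C Y W" "j \<in> Hom C Z W" "i \<cdot> f = j \<cdot> g"
proof -
  obtain i j where po: "pushout_square C f g i j"
    using ex_pushout_square[of f g] HomD[OF assms(1)] HomD[OF assms(2)] by auto
  show thesis using that[OF po pushout_typing[OF po assms]] .
qed

text \<open>
  Let \<open>W1\<close> be the pushout of \<open>Y \<leftarrow> X \<rightarrow> Z'\<close>, and \<open>Y1\<close> that of \<open>Y \<leftarrow> X \<rightarrow> X'\<close>. The map \<open>w\<close> factors
  through \<open>W1\<close>. The first factor \<open>W \<rightarrow> W1\<close> is a pushout of \<open>z\<close> along the \<open>E\<close>-monic \<open>j\<close>. Since \<open>W1\<close> is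
  also the pushout of \<open>Y1 \<leftarrow> X' \<rightarrow> Z'\<close>, the second factor \<open>W1 \<rightarrow> W'\<close> is the cobase change along \<open>g'\<close> of
  \<open>t : Y1 \<rightarrow> Y'\<close>, a map under \<open>X'\<close>; and \<open>t\<close> is a stable equivalence by cancellation, because
  \<open>Y \<rightarrow> Y1\<close> is a pushout of \<open>x\<close> along \<open>f\<close>.
\<close>

lemma gluing:
  assumes T: "f \<in> Hom C X Y" "g \<in> Hom C X Z" "f' \<in> Hom C X' Y'" "g' \<in> Hom C X' Z'"
    and m: "rel_monic C E f" "rel_monic C E f'"
    and po: "pushout_square C f g i j" and po': "pushout_square C f' g' i' j'"
    and i: "i \<in> Hom C Y W" and i': "i' \<in> Hom C Y' W'"
    and x: "x \<in> Hom C X X'" "stable_equivalence C E x"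
    and y: "y \<in> Hom C Y Y'" "stable_equivalence C E y"
    and z: "z \<in> Hom C Z Z'" "stable_equivalence C E z"
    and yf: "y \<cdot> f = f' \<cdot> x" and zg: "z \<cdot> g = g' \<cdot> x"
    and w: "w \<in> Hom C W W'" "w \<cdot> i = i' \<cdot> y" "w \<cdot> j = j' \<cdot> z"
  shows "stable_equivalence C E w"
proof -
  have j: "j \<in> Hom C Z W" and comm: "i \<cdot> f = j \<cdot> g"
    using pushout_typing[OF po T(1,2)] HomD(3)[OF i] by simp_all
  have j': "j' \<in> Hom C Z' W'" and comm': "i' \<cdot> f' = j' \<cdot> g'"
    using pushout_typing[OF po' T(3,4)] HomD(3)[OF i'] by simp_all
  obtain om j1 W1 where po1: "pushout_square C j z om j1"
    and om: "om \<in> Hom C W W1" and j1: "j1 \<in> Hom C Z' W1" and comm1: "om \<cdot> j = j1 \<cdot> z"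
    by (rule ex_pushout[OF j z(1)])
  obtain k f1 Y1 where po2: "pushout_square C f x k f1"
    and k: "k \<in> Hom C Y Y1" and f1: "f1 \<in> Hom C X' Y1" and comm2: "k \<cdot> f = f1 \<cdot> x"
    by (rule ex_pushout[OF T(1) x(1)])
  note [simp] = HomD[OF T(1)] HomD[OF T(2)] HomD[OF T(3)] HomD[OF T(4)] HomD[OF i] HomD[OF i']
    HomD[OF j] HomD[OF j'] HomD[OF x(1)] HomD[OF y(1)] HomD[OF z(1)] HomD[OF w(1)] HomD[OF om]
    HomD[OF j1] HomD[OF k] HomD[OF f1]
  have "rel_monic C E j"
    by (rule pushout_rel_monic[OF pushout_commute[OF po] T(2,1) m(1)])
  then have omw: "stable_equivalence C E om"
    by (rule pushout_stable_equivalence[OF j _ z po1])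
  have kw: "stable_equivalence C E k"
    by (rule pushout_stable_equivalence[OF T(1) m(1) x po2])
  obtain t where t: "t \<in> Hom C Y1 Y'" "t \<cdot> k = y" "t \<cdot> f1 = f'"
    by (rule pushout_induced[OF po2 T(1) x(1) k y(1) T(3) yf])
  note [simp] = HomD[OF t(1)]
  have tw: "stable_equivalence C E t"
    using stable_equivalence_cases(2)[OF k t(1) kw] t(2) y(2) by simp
  have "(om \<cdot> i) \<cdot> f = (j1 \<cdot> g') \<cdot> x"
    by (simp add: comm reassoc[OF comm1] zg)
  then obtain i1 where i1: "i1 \<in> Hom C Y1 W1" "i1 \<cdot> k = om \<cdot> i" "i1 \<cdot> f1 = j1 \<cdot> g'"
    by (rule pushout_induced[OF po2 T(1) x(1) k Comp_in_Hom[OF i om] Comp_in_Hom[OF T(4) j1]])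
  note [simp] = HomD[OF i1(1)]
  \<comment> \<open>Pasting: \<open>f\<close> with \<open>g\<close> and then \<open>z\<close> is the same as \<open>f\<close> with \<open>x\<close> and then \<open>g'\<close>.\<close>
  have po3: "pushout_square C f1 g' i1 j1"
  proof (rule pushout_squareI[OF f1 T(4) i1(1) j1 i1(3)])
    fix Q u v assume u: "u \<in> Hom C Y1 Q" and v: "v \<in> Hom C Z' Q" and uv: "u \<cdot> f1 = v \<cdot> g'"
    note [simp] = HomD[OF u] HomD[OF v]
    have "(u \<cdot> k) \<cdot> f = (v \<cdot> z) \<cdot> g"
      by (simp add: comm2 zg reassoc[OF uv])
    then obtain n where n: "n \<in> Hom C W Q" "n \<cdot> i = u \<cdot> k" "n \<cdot> j = v \<cdot> z"
      by (rule pushout_induced[OF po T(1,2) i Comp_in_Hom[OF k u] Comp_in_Hom[OF z(1) v]])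
    obtain l where l: "l \<in> Hom C W1 Q" "l \<cdot> om = n" "l \<cdot> j1 = v"
      by (rule pushout_induced[OF po1 j z(1) om n(1) v n(3)])
    note [simp] = HomD[OF n(1)] HomD[OF l(1)]
    have "l \<cdot> i1 = u"
    proof (rule pushout_eqI[OF po2 T(1) x(1) k Comp_in_Hom[OF i1(1) l(1)] u])
      show "l \<cdot> i1 \<cdot> k = u \<cdot> k" by (simp add: i1 reassoc[OF l(2)] n)
      show "l \<cdot> i1 \<cdot> f1 = u \<cdot> f1" by (simp add: i1 reassoc[OF l(3)] uv)
    qed
    then show "\<exists>w \<in> Hom C W1 Q. w \<cdot> i1 = u \<and> w \<cdot> j1 = v" using l by blast
  next
    fix Q u v assume u: "u \<in> Hom C W1 Q" and v: "v \<in> Hom C W1 Q"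
      and uv: "u \<cdot> i1 = v \<cdot> i1" "u \<cdot> j1 = v \<cdot> j1"
    note [simp] = HomD[OF u] HomD[OF v]
    have "u \<cdot> om = v \<cdot> om"
    proof (rule pushout_eqI[OF po T(1,2) i Comp_in_Hom[OF om u] Comp_in_Hom[OF om v]])
      have "u \<cdot> (i1 \<cdot> k) = v \<cdot> (i1 \<cdot> k)" by (simp add: reassoc[OF uv(1)] del: i1)
      then show "u \<cdot> om \<cdot> i = v \<cdot> om \<cdot> i" by (simp add: i1)
      show "u \<cdot> om \<cdot> j = v \<cdot> om \<cdot> j" by (simp add: comm1 reassoc[OF uv(2)])
    qed
    then show "u = v" using uv(2) by (rule pushout_eqI[OF po1 j z(1) om u v])
  qed
  obtain w1 where w1: "w1 \<in> Hom C W1 W'" "w1 \<cdot> om = w" "w1 \<cdot> j1 = j'"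
    by (rule pushout_induced[OF po1 j z(1) om w(1) j' w(3)])
  note [simp] = HomD[OF w1(1)]
  have "w1 \<cdot> i1 = i' \<cdot> t"
  proof (rule pushout_eqI[OF po2 T(1) x(1) k Comp_in_Hom[OF i1(1) w1(1)] Comp_in_Hom[OF t(1) i']])
    show "w1 \<cdot> i1 \<cdot> k = i' \<cdot> t \<cdot> k" by (simp add: i1 t reassoc[OF w1(2)] w)
    show "w1 \<cdot> i1 \<cdot> f1 = i' \<cdot> t \<cdot> f1" by (simp add: i1 t reassoc[OF w1(3)] comm')
  qed
  then have "stable_equivalence C E w1"
    using pushout_stable_equivalence_under[OF f1 T(3) m(2) t(1) tw t(3) T(4) po3 po' i1(1) i' w1(1) _ w1(3)]
    by blast
  then show ?thesis using stable_equivalence_cases(1)[OF om w1(1) omw] w1(2) by simp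
qed

text \<open>
  Factor \<open>y\<close> as \<open>p j\<close> through the pushout \<open>W\<close> of \<open>Y \<leftarrow> X \<rightarrow> X'\<close>. The induced \<open>X' \<rightarrow> W \<rightarrow> Z\<close> is short
  exact and maps to \<open>X' \<rightarrow> Y' \<rightarrow> Z'\<close> with identity on \<open>X'\<close>, which makes the right-hand square
  bicartesian: \<open>(p, p') : W \<rightarrow> Y' \<oplus> Z\<close> is monic with cokernel \<open>(q', -z)\<close>, hence the kernel of
  \<open>(q', -z)\<close>. So \<open>p\<close> is the pullback of \<open>z\<close> along \<open>q'\<close>.
\<close>

lemma extension:
  assumes f: "f \<in> Hom C X Y" "rel_monic C E f" and f': "f' \<in> Hom C X' Y'" "rel_monic C E f'"
    and q: "is_cokernel C q f" "q \<in> Hom C Y Z" and q': "is_cokernel C q' f'" "q' \<in> Hom C Y' Z'"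
    and x: "x \<in> Hom C X X'" "stable_equivalence C E x"
    and y: "y \<in> Hom C Y Y'"
    and z: "z \<in> Hom C Z Z'" "stable_equivalence C E z"
    and yf: "y \<cdot> f = f' \<cdot> x" and zq: "z \<cdot> q = q' \<cdot> y"
  shows "stable_equivalence C E y"
proof -
  obtain j k W where po: "pushout_square C f x j k"
    and j: "j \<in> Hom C Y W" and k: "k \<in> Hom C X' W" and comm: "j \<cdot> f = k \<cdot> x"
    by (rule ex_pushout[OF f(1) x(1)])
  note [simp] = HomD[OF f(1)] HomD[OF f'(1)] HomD[OF q(2)] HomD[OF q'(2)] HomD[OF x(1)] HomD[OF y]
    HomD[OF z(1)] HomD[OF j] HomD[OF k]
  note qf = cokernel_zero[OF q(1) f(1) q(2)] and qf' = cokernel_zero[OF q'(1) f'(1) q'(2)]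
  have jw: "stable_equivalence C E j"
    by (rule pushout_stable_equivalence[OF f x po])
  have km: "monic C k"
    using pushout_rel_monic[OF pushout_commute[OF po] x(1) f] by (simp add: rel_monic_def)
  obtain p where p: "p \<in> Hom C W Y'" "p \<cdot> j = y" "p \<cdot> k = f'"
    by (rule pushout_induced[OF po f(1) x(1) j y f'(1) yf])
  have "q \<cdot> f = Zero C X' Z \<cdot> x" "Zero C X' Z \<in> Hom C X' Z" using qf by (simp_all add: Hom_def)
  then obtain p' where p': "p' \<in> Hom C W Z" "p' \<cdot> j = q" "p' \<cdot> k = Zero C X' Z"
    using pushout_induced[OF po f(1) x(1) j q(2)] by metis
  note [simp] = HomD[OF p(1)] HomD[OF p'(1)]
  have qp: "q' \<cdot> p = z \<cdot> p'"
  proof (rule pushout_eqI[OF po f(1) x(1) j Comp_in_Hom[OF p(1) q'(2)] Comp_in_Hom[OF p'(1) z(1)]])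
    show "q' \<cdot> p \<cdot> j = z \<cdot> p' \<cdot> j" by (simp add: p p' zq)
    show "q' \<cdot> p \<cdot> k = z \<cdot> p' \<cdot> k" by (simp add: p p' qf')
  qed
  have pk: "is_cokernel C p' k"
  proof (rule is_cokernelI[OF k p'(1,3)])
    fix Q u assume u: "u \<in> Hom C W Q" "u \<cdot> k = Zero C X' Q"
    note [simp] = HomD[OF u(1)]
    have "(u \<cdot> j) \<cdot> f = Zero C X Q" by (simp add: comm reassoc[OF u(2)])
    then obtain v where v: "v \<in> Hom C Z Q" "v \<cdot> q = u \<cdot> j"
      by (rule cokernel_extend[OF q f(1) Comp_in_Hom[OF j u(1)]])
    note [simp] = HomD[OF v(1)]
    have "v \<cdot> p' = u"
    proof (rule pushout_eqI[OF po f(1) x(1) j Comp_in_Hom[OF p'(1) v(1)] u(1)])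
      show "v \<cdot> p' \<cdot> j = u \<cdot> j" by (simp add: p' v)
      show "v \<cdot> p' \<cdot> k = u \<cdot> k" by (simp add: p' u(2))
    qed
    then show "\<exists>v \<in> Hom C Z Q. v \<cdot> p' = u" using v by blast
  next
    fix Q u v assume u: "u \<in> Hom C Z Q" and v: "v \<in> Hom C Z Q" and uv: "u \<cdot> p' = v \<cdot> p'"
    note [simp] = HomD[OF u] HomD[OF v]
    have "u \<cdot> (p' \<cdot> j) = v \<cdot> (p' \<cdot> j)" by (simp add: reassoc[OF uv] del: p')
    then show "u = v" by (intro cokernel_eqI[OF q u v]) (simp add: p')
  qed
  have kk: "is_kernel C k p'"
    using monic_normal[OF km] monic_is_kernel_of_cokernel[OF _ pk] by blast
  \<comment> \<open>\<open>p'\<close> detects everything but the image of \<open>X'\<close>, on which \<open>p\<close> is the monic \<open>f'\<close>.\<close>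
  have joint: "d = Zero C A W"
    if d: "d \<in> Hom C A W" "p \<cdot> d = Zero C A Y'" "p' \<cdot> d = Zero C A Z" for A d
  proof -
    obtain n where n: "n \<in> Hom C A X'" "k \<cdot> n = d"
      by (rule kernel_lift[OF kk k p'(1) d(1,3)])
    note [simp] = HomD[OF d(1)] HomD[OF n(1)]
    have "f' \<cdot> n = p \<cdot> (k \<cdot> n)" by (simp add: reassoc[OF p(3)])
    also have "\<dots> = f' \<cdot> Zero C A X'" using d(2) n(2) by simp
    finally have "n = Zero C A X'"
      using f'(2) by (intro monicD[OF _ f'(1) n(1)]) (simp_all add: rel_monic_def Hom_def)
    then show ?thesis using n(2) by simp
  qed
  have joint_eq: "u = v"
    if "u \<in> Hom C A W" "v \<in> Hom C A W" "p \<cdot> u = p \<cdot> v" "p' \<cdot> u = p' \<cdot> v" for A u v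
  proof -
    note [simp] = HomD[OF that(1)] HomD[OF that(2)]
    have "u \<ominus> v = Zero C A W"
      by (rule joint) (simp_all add: Hom_def that(3,4))
    then show ?thesis by (simp add: minus_eq_iff)
  qed
  obtain S i1 i2 p1 p2 where S:
    "i1 \<in> Hom C Y' S" "i2 \<in> Hom C Z S" "p1 \<in> Hom C S Y'" "p2 \<in> Hom C S Z"
    and e: "p1 \<cdot> i1 = Ident C Y'" "p2 \<cdot> i2 = Ident C Z"
    "p1 \<cdot> i2 = Zero C Z Y'" "p2 \<cdot> i1 = Zero C Y' Z"
    "(i1 \<cdot> p1) \<oplus> (i2 \<cdot> p2) = Ident C S"
    by (rule biproduct[of Y' Z]) simp_all
  note [simp] = HomD[OF S(1)] HomD[OF S(2)] HomD[OF S(3)] HomD[OF S(4)]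
  note es = e(1-4) reassoc[OF e(1)] reassoc[OF e(2)] reassoc[OF e(3)] reassoc[OF e(4)]
  define m where "m = i1 \<cdot> p \<oplus> i2 \<cdot> p'"
  define n where "n = q' \<cdot> p1 \<ominus> z \<cdot> p2"
  have m: "m \<in> Hom C W S" and n: "n \<in> Hom C S Z'" by (simp_all add: m_def n_def Hom_def)
  have pm: "p1 \<cdot> m = p" "p2 \<cdot> m = p'" by (simp_all add: m_def es)
  note [simp] = HomD[OF m] HomD[OF n]
  have nm: "is_cokernel C n m"
  proof (rule is_cokernelI[OF m n])
    show "n \<cdot> m = Zero C W Z'" by (simp add: n_def pm qp)
    fix Q g assume g: "g \<in> Hom C S Q" "g \<cdot> m = Zero C W Q"
    note [simp] = HomD[OF g(1)]
    have gm: "(g \<cdot> i1) \<cdot> p \<oplus> (g \<cdot> i2) \<cdot> p' = Zero C W Q"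
      using g(2) by (simp add: m_def)
    have "((g \<cdot> i1) \<cdot> p \<oplus> (g \<cdot> i2) \<cdot> p') \<cdot> k = (g \<cdot> i1) \<cdot> f'"
      by (simp add: p p')
    then have "(g \<cdot> i1) \<cdot> f' = Zero C X' Q" unfolding gm by simp
    then obtain v where v: "v \<in> Hom C Z' Q" "v \<cdot> q' = g \<cdot> i1"
      by (rule cokernel_extend[OF q' f'(1) Comp_in_Hom[OF S(1) g(1)]])
    note [simp] = HomD[OF v(1)]
    have "(v \<cdot> z \<oplus> g \<cdot> i2) \<cdot> p' = (v \<cdot> q') \<cdot> p \<oplus> (g \<cdot> i2) \<cdot> p'" by (simp add: qp)
    also have "\<dots> = Zero C Z Q \<cdot> p'" unfolding v(2) gm by simp
    finally have vzp: "(v \<cdot> z \<oplus> g \<cdot> i2) \<cdot> p' = Zero C Z Q \<cdot> p'" .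
    have "v \<cdot> z \<oplus> g \<cdot> i2 \<in> Hom C Z Q" "Zero C Z Q \<in> Hom C Z Q" by (simp_all add: Hom_def)
    then have vz: "v \<cdot> z \<oplus> g \<cdot> i2 = Zero C Z Q" using vzp by (rule cokernel_eqI[OF pk p'(1)])
    have "v \<cdot> n \<oplus> (v \<cdot> z \<oplus> g \<cdot> i2) \<cdot> p2 = (v \<cdot> q') \<cdot> p1 \<oplus> (g \<cdot> i2) \<cdot> p2"
      by (simp add: n_def arr_simps)
    also have "\<dots> = g" unfolding v(2) by (rule biproduct_decompose[OF S e(5) g(1), symmetric])
    finally have "v \<cdot> n = g" unfolding vz by simp
    then show "\<exists>v \<in> Hom C Z' Q. v \<cdot> n = g" using v(1) by blast
  next
    fix Q u v assume u: "u \<in> Hom C Z' Q" and v: "v \<in> Hom C Z' Q" and uv: "u \<cdot> n = v \<cdot> n"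
    note [simp] = HomD[OF u] HomD[OF v]
    have ni: "n \<cdot> i1 = q'" by (simp add: n_def es)
    have "u \<cdot> (n \<cdot> i1) = v \<cdot> (n \<cdot> i1)" by (simp add: reassoc[OF uv])
    then show "u = v" unfolding ni by (rule cokernel_eqI[OF q' u v])
  qed
  have "monic C m" unfolding monic_def
  proof (intro conjI ballI impI)
    fix A u v assume "u \<in> Hom C A (Dom C m)" "v \<in> Hom C A (Dom C m)" and uv: "m \<cdot> u = m \<cdot> v"
    then have u: "u \<in> Hom C A W" and v: "v \<in> Hom C A W" by simp_all
    note [simp] = HomD[OF u] HomD[OF v]
    have "p1 \<cdot> (m \<cdot> u) = p1 \<cdot> (m \<cdot> v)" "p2 \<cdot> (m \<cdot> u) = p2 \<cdot> (m \<cdot> v)" using uv by simp_all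
    then have "p \<cdot> u = p \<cdot> v" "p' \<cdot> u = p' \<cdot> v" by (simp_all add: reassoc[OF pm(1)] reassoc[OF pm(2)])
    then show "u = v" by (rule joint_eq[OF u v])
  qed simp
  then have mn: "is_kernel C m n"
    using monic_normal monic_is_kernel_of_cokernel[OF _ nm] by blast
  have "stable_equivalence C E p"
  proof (rule pullback_stable_equivalence[OF z q'(2) _ p(1) p'(1) qp _ joint_eq])
    show "\<exists>v \<in> Hom C P Y'. q' \<cdot> v = u" if "rel_projective C E P" "u \<in> Hom C P Z'" for P u
      using projective_lift_cokernel[OF allowable that(1) f'(2,1) q' that(2)] by metis
    fix A u v assume u: "u \<in> Hom C A Y'" and v: "v \<in> Hom C A Z" and uv: "q' \<cdot> u = z \<cdot> v"
    note [simp] = HomD[OF u] HomD[OF v]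
    have "n \<cdot> (i1 \<cdot> u \<oplus> i2 \<cdot> v) = Zero C A Z'" by (simp add: n_def es uv arr_simps)
    moreover have "i1 \<cdot> u \<oplus> i2 \<cdot> v \<in> Hom C A S" by (simp add: Hom_def)
    ultimately obtain w where w: "w \<in> Hom C A W" "m \<cdot> w = i1 \<cdot> u \<oplus> i2 \<cdot> v"
      using kernel_lift[OF mn m n] by metis
    note [simp] = HomD[OF w(1)]
    have "p \<cdot> w = p1 \<cdot> (m \<cdot> w)" "p' \<cdot> w = p2 \<cdot> (m \<cdot> w)"
      by (simp_all add: reassoc[OF pm(1)] reassoc[OF pm(2)])
    then have "p \<cdot> w = u" "p' \<cdot> w = v" unfolding w(2) by (simp_all add: es)
    then show "\<exists>w \<in> Hom C A W. p \<cdot> w = u \<and> p' \<cdot> w = v" using w(1) by blast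
  qed
  then show ?thesis using stable_equivalence_cases(1)[OF j p(1) jw] p(2) by simp
qed

end

section \<open>The Waldhausen structure\<close>

theorem mainTheorem1:
  fixes C :: "('o, 'a) add_cat" and E F :: "('a \<times> 'a) set"
  assumes "abelian_category C"
    and "allowable_class C E" and "allowable_class C F" and "F \<subseteq> E"
    and "retractile_monics C F"
    and "retractile_monics C E" and "sectile_epics C E"
    and "enough_injectives C F"
    and "enough_projectives C E" and "enough_injectives C E"
    and "\<And>X. rel_projective C E X \<Longrightarrow> rel_injective C E X"
  shows "\<exists>pt cof weq.
    cof = {f. rel_monic C F f} \<and>
    weq = {f. stable_equivalence C E f} \<and>
    waldhausen_category C pt cof weq \<and>
    saturation_axiom C weq \<and>
    extension_axiom C pt cof weq"
proof -
  interpret abelian_category C by fact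
  interpret F: relative_injectives C F
    by (intro relative_injectives.intro relative_injectives_axioms.intro assms)
  interpret E: relative_stable C E
    by (intro relative_stable.intro relative_injectives.intro relative_injectives_axioms.intro
        relative_stable_axioms.intro assms)
  define cof weq where "cof = {f. rel_monic C F f}" and "weq = {f. stable_equivalence C E f}"
  have cofI: "f \<in> cof \<longleftrightarrow> rel_monic C F f" and weqI: "f \<in> weq \<longleftrightarrow> stable_equivalence C E f" for f
    by (simp_all add: cof_def weq_def)
  have FE: "rel_monic C E f" if "f \<in> cof" for f
    using that \<open>F \<subseteq> E\<close> unfolding cofI rel_monic_def by blast
  obtain pt where pt: "zero_object C pt" using ex_zero_object by blast
  have weq_Arr: "f \<in> Arr C" if "f \<in> weq" for f
    using that by (simp add: weqI stable_equivalence_def)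
  have comp: "f \<in> Hom C (Dom C f) (Cod C f)" "g \<in> Hom C (Cod C f) (Cod C g)" if "composable C g f" for f g
    using that by (simp_all add: composable_def Hom_def)
  have "waldhausen_category C pt cof weq"
  proof (intro waldhausen_category.intro waldhausen_category_axioms.intro)
    show "category C" by (rule category_axioms)
    show "zero_object C pt" by (rule pt)
    show "\<exists>i j. pushout_square C f g i j" if "f \<in> Arr C" "g \<in> Arr C" "Dom C f = Dom C g" for f g
      using that by (rule ex_pushout_square)
    show "cof \<subseteq> Arr C" using F.rel_monic_typing HomD(1) unfolding cof_def by blast
    show "weq \<subseteq> Arr C" using weq_Arr by blast
    show "g \<cdot>\<^bsub>C\<^esub> f \<in> cof" if "f \<in> cof" "g \<in> cof" "composable C g f" for f g
      using F.rel_monic_comp[OF comp(1)[OF that(3)] _ comp(2)[OF that(3)]] that(1,2) unfolding cofI by blast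
    show "g \<cdot>\<^bsub>C\<^esub> f \<in> weq" if "f \<in> weq" "g \<in> weq" "composable C g f" for f g
      using stable_equivalence_cases(1)[OF comp[OF that(3)]] that(1,2) unfolding weqI by blast
    show "f \<in> cof" if "iso_arr C f" for f
      using iso_rel_monic[OF assms(3) that] unfolding cofI .
    show "f \<in> cof" if "X \<in> Obj C" "f \<in> Hom C pt X" for X f
      using from_zero_object_rel_monic[OF assms(3) pt that(2)] unfolding cofI .
    show "i \<in> cof" if "g \<in> cof" and po: "pushout_square C f g i j" for g f i j
    proof -
      have "f \<in> Hom C (Dom C f) (Cod C f)" "g \<in> Hom C (Dom C f) (Cod C g)"
        using po by (simp_all add: pushout_square_def Hom_def)
      then show ?thesis using F.pushout_rel_monic[OF po] that(1) unfolding cofI by blast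
    qed
    show "f \<in> weq" if "iso_arr C f" for f
      using iso_stable_equivalence[OF that] unfolding weqI .
    show "w \<in> weq"
      if po: "pushout_square C f g i j" and po': "pushout_square C f' g' i' j'"
        and "f \<in> cof" "f' \<in> cof" and xyz: "x \<in> weq" "y \<in> weq" "z \<in> weq"
        and "x \<in> Hom C (Dom C f) (Dom C f')" "y \<in> Hom C (Cod C f) (Cod C f')"
          "z \<in> Hom C (Cod C g) (Cod C g')"
        and "y \<cdot>\<^bsub>C\<^esub> f = f' \<cdot>\<^bsub>C\<^esub> x" "z \<cdot>\<^bsub>C\<^esub> g = g' \<cdot>\<^bsub>C\<^esub> x"
        and "w \<in> Hom C (Cod C i) (Cod C i')" "w \<cdot>\<^bsub>C\<^esub> i = i' \<cdot>\<^bsub>C\<^esub> y" "w \<cdot>\<^bsub>C\<^esub> j = j' \<cdot>\<^bsub>C\<^esub> z"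
      for f g i j f' g' i' j' x y z w
    proof -
      have T: "f \<in> Hom C (Dom C f) (Cod C f)" "g \<in> Hom C (Dom C f) (Cod C g)"
        "f' \<in> Hom C (Dom C f') (Cod C f')" "g' \<in> Hom C (Dom C f') (Cod C g')"
        using po po' by (simp_all add: pushout_square_def Hom_def)
      show ?thesis unfolding weqI
        by (rule E.gluing[OF T FE FE po po' pushout_typing(1)[OF po T(1,2)] pushout_typing(1)[OF po' T(3,4)]])
          (use that in \<open>simp_all only: weqI\<close>)
    qed
  qed
  moreover have "saturation_axiom C weq"
    unfolding saturation_axiom_def weqI using stable_equivalence_cases[OF comp] by blast
  moreover have "extension_axiom C pt cof weq"
    unfolding extension_axiom_def
  proof (intro allI impI, elim conjE)
    fix f q f' q' x y z
    assume c: "cofiber_sequence C pt cof f q" and c': "cofiber_sequence C pt cof f' q'"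
      and x: "x \<in> Hom C (Dom C f) (Dom C f')" and y: "y \<in> Hom C (Cod C f) (Cod C f')"
      and z: "z \<in> Hom C (Cod C q) (Cod C q')"
      and e: "y \<cdot>\<^bsub>C\<^esub> f = f' \<cdot>\<^bsub>C\<^esub> x" "z \<cdot>\<^bsub>C\<^esub> q = q' \<cdot>\<^bsub>C\<^esub> y" and w: "x \<in> weq" "z \<in> weq"
    have *: "f \<in> Hom C (Dom C f) (Cod C f) \<and> rel_monic C E f \<and> is_cokernel C q f \<and>
        q \<in> Hom C (Cod C f) (Cod C q)" if cs: "cofiber_sequence C pt cof f q" for f q
    proof -
      obtain t s where f: "f \<in> cof" and t: "t \<in> Hom C (Dom C f) pt" and po: "pushout_square C f t q s"
        using cs unfolding cofiber_sequence_def by blast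
      have fH: "f \<in> Hom C (Dom C f) (Cod C f)" using E.rel_monic_typing[OF FE[OF f]] .
      show ?thesis
        using fH FE[OF f] cofiber_is_cokernel[OF pt fH t po] pushout_typing(1)[OF po fH t] by blast
    qed
    note c = *[OF c] and c' = *[OF c']
    show "y \<in> weq" unfolding weqI
      by (rule E.extension[where f = f and f' = f' and q = q and q' = q' and x = x and z = z])
        (use c c' x y z e w in \<open>simp_all only: weqI\<close>)
  qed
  ultimately show ?thesis unfolding cof_def weq_def by blast
qed

end
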